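(* Let $P$ be a poset and let $\mathfrak F=(F_n,\phi_n)$ be a chain complex of modules over a ring, with a fixed $P$-grading $F_n=\bigoplus_{c\in P}F_n^c$. For each $c\in P$ let $V_c$ be a vector field on the stratum $\overline{\mathfrak F(c)}$, and let $V=\bigoplus_cV_c$ be the induced vector field on $\mathfrak F$. Fix $n$, consider the subposet $P_n=\{c\in P\mid F_n^c\ne0\}$ of $P$, and let $a\in P_n$ be of finite dimension $d_{P_n}(a)$. Suppose that for each $c\in P_n$ with $c\le a$ the vector field $V_c$ is a partial splitting of $\overline{\mathfrak F(c)}$, and let $F_n^c=N^c_{n+1}\oplus C^c_n\oplus M^c_n$ be the corresponding decomposition. (Below, indices $b,c$ range over elements of $P_n$.) Then for any collection of nonnegative integers $\{k_c\mid c\le a\}$ we have $$\sum_{c\le a}\Phi_V^{k_c}(C_n^c)=\bigoplus_{c\le a}\Phi_V^{k_c}(C_n^c),$$ and each restriction $\Phi_V^{k_c}\colon C_n^c\to\Phi_V^{k_c}(C_n^c)$ is an isomorphism. Furthermore, for each integer $k>d_{P_n}(a)$ we also have: 1. $\Phi_V^k(M_n^a)=0$; 2. $[\Phi_V-\mathrm{id}](C_n^a)\subseteq\bigoplus_{b<a}M_n^b$; 3. $[\Phi_V^k-\Phi_V^{k-1}](C_n^a)=0$; 4. $\Phi_V^k(N_{n+1}^a)\subseteq\bigoplus_{b<a}\Phi_V^{d_{P_n}(b)}(C_n^b)$; 5. $[\Phi_V^{k+1}-\Phi_V^k](F_n^a)=0$; 6. $\Phi_V^k(F_n^a)\subseteq\bigoplus_{b\le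 a}\Phi_V^{d_{P_n}(b)}(C_n^b)$; 7. $[\Phi_V^{k+1}-\Phi_V^k](\mathfrak F(a)_n)=0$; 8. $\Phi_V^k(\mathfrak F(a)_n)=\bigoplus_{b\le a}\Phi_V^{d_{P_n}(b)}(C_n^b)$.
   Context: Rings are associative with unit, modules are left and unitary; $\phi_n\colon F_n\to F_{n-1}$. A chain homotopy on $\mathfrak F$ is a family $D$ of module homomorphisms $F_n\to F_{n+1}$; $\Phi_D=\mathrm{id}-\phi D-D\phi$. A vector field is a chain homotopy $V$ with $V^2=0$; $\Phi_V$ is its flow. A partial splitting is a vector field $D$ with $D\phi D=D$. For a partial splitting $D$ of a complex $(F_n,\phi_n)$ one has the decomposition $F_n=N_{n+1}\oplus C_n\oplus M_n$ with $N_{n+1}=\operatorname{Im}(\phi D|_{F_n})$, $M_n=\operatorname{Im}(D\phi|_{F_n})$, $C_n=\operatorname{Ker}(D\phi|_{F_n})\cap\operatorname{Ker}(\phi D|_{F_n})$. A $P$-grading (or $P$-stratification) on $\mathfrak F$ is a decomposition $F_n=\bigoplus_{a\in P}F_n^a$ for every $n$ such that for each $a\in P$ the modules $F_n(a)=\bigoplus_{x\le a}F_n^x$ form a subcomplex $\mathfrak F(a)$ of $\mathfrak F$; so $\mathfrak F(a)_n=F_n(a)$. The stratum at $a$ is $\overline{\mathfrak F(a)}=\mathfrak F(a)/\sum_{b<a}\mathfrak F(b)$, so $\overline{\mathfrak F(a)}_n=F_n^a$. Each vector field $V_c$ on $\overline{\mathfrak F(c)}$ is viewed as a chain homotopy on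 $\mathfrak F$ via $F_n^c\subseteq F_n$, by being zero on $F_n^b$ for $b\ne c$; the induced vector field $V$ is the sum of these. For a poset $P$ and $a\in P$, $d_P(a)$ is the supremum of the lengths $n$ of strictly increasing chains $a_0<\dots<a_n=a$ in $P$. *)

theory Defs
  imports "HOL-Algebra.Module" "HOL-Algebra.AbelCoset" "HOL-Library.Extended_Nat"
begin

section \<open>Left modules and homomorphisms\<close>

text \<open>The locale \<^locale>\<open>module\<close> requires a commutative ring of scalars. Here scalars form an
  arbitrary associative unital ring.\<close>

locale left_module = R?: ring R + M?: abelian_group M
  for R :: "('r, 's) ring_scheme" (structure) and M :: "('r, 'm, 'x) module_scheme" (structure) +
  assumes smult_closed [simp, intro]:
      "\<lbrakk>r \<in> carrier R; x \<in> carrier M\<rbrakk> \<Longrightarrow> r \<odot>\<^bsub>M\<^esub> x \<in> carrier M"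
    and smult_l_distr:
      "\<lbrakk>r \<in> carrier R; s \<in> carrier R; x \<in> carrier M\<rbrakk> \<Longrightarrow>
        (r \<oplus> s) \<odot>\<^bsub>M\<^esub> x = r \<odot>\<^bsub>M\<^esub> x \<oplus>\<^bsub>M\<^esub> s \<odot>\<^bsub>M\<^esub> x"
    and smult_r_distr:
      "\<lbrakk>r \<in> carrier R; x \<in> carrier M; y \<in> carrier M\<rbrakk> \<Longrightarrow>
        r \<odot>\<^bsub>M\<^esub> (x \<oplus>\<^bsub>M\<^esub> y) = r \<odot>\<^bsub>M\<^esub> x \<oplus>\<^bsub>M\<^esub> r \<odot>\<^bsub>M\<^esub> y"
    and smult_assoc1:
      "\<lbrakk>r \<in> carrier R; s \<in> carrier R; x \<in> carrier M\<rbrakk> \<Longrightarrow>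
        (r \<otimes> s) \<odot>\<^bsub>M\<^esub> x = r \<odot>\<^bsub>M\<^esub> (s \<odot>\<^bsub>M\<^esub> x)"
    and smult_one [simp]:
      "x \<in> carrier M \<Longrightarrow> \<one> \<odot>\<^bsub>M\<^esub> x = x"

definition module_hom ::
  "('r, 's) ring_scheme \<Rightarrow> ('r, 'a, 'x) module_scheme \<Rightarrow> ('r, 'b, 'y) module_scheme \<Rightarrow> ('a \<Rightarrow> 'b) set"
  where "module_hom R M N =
    {h. h \<in> carrier M \<rightarrow> carrier N
      \<and> (\<forall>x\<in>carrier M. \<forall>y\<in>carrier M. h (x \<oplus>\<^bsub>M\<^esub> y) = h x \<oplus>\<^bsub>N\<^esub> h y)
      \<and> (\<forall>r\<in>carrier R. \<forall>x\<in>carrier M. h (r \<odot>\<^bsub>M\<^esub> x) = r \<odot>\<^bsub>N\<^esub> h x)}"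

definition module_iso ::
  "('r, 's) ring_scheme \<Rightarrow> ('r, 'a, 'x) module_scheme \<Rightarrow> ('r, 'b, 'y) module_scheme \<Rightarrow> ('a \<Rightarrow> 'b) set"
  where "module_iso R M N = {h \<in> module_hom R M N. bij_betw h (carrier M) (carrier N)}"


section \<open>Sums of families of submodules\<close>

definition submodule_sum :: "('m, 'x) ring_scheme \<Rightarrow> 'i set \<Rightarrow> ('i \<Rightarrow> 'm set) \<Rightarrow> 'm set"
  where "submodule_sum M I S =
    {x. \<exists>J f. finite J \<and> J \<subseteq> I \<and> f \<in> Pi J S \<and> x = (\<Oplus>\<^bsub>M\<^esub>i\<in>J. f i)}"

text \<open>The sum of a family of submodules is direct: zero is only represented trivially.\<close>

definition direct :: "('m, 'x) ring_scheme \<Rightarrow> 'i set \<Rightarrow> ('i \<Rightarrow> 'm set) \<Rightarrow> bool"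
  where "direct M I S \<longleftrightarrow>
    (\<forall>J f. finite J \<longrightarrow> J \<subseteq> I \<longrightarrow> f \<in> Pi J S \<longrightarrow> (\<Oplus>\<^bsub>M\<^esub>i\<in>J. f i) = \<zero>\<^bsub>M\<^esub> \<longrightarrow> (\<forall>i\<in>J. f i = \<zero>\<^bsub>M\<^esub>))"

definition is_direct_sum ::
  "('m, 'x) ring_scheme \<Rightarrow> 'm set \<Rightarrow> 'i set \<Rightarrow> ('i \<Rightarrow> 'm set) \<Rightarrow> bool"
  where "is_direct_sum M X I S \<longleftrightarrow> direct M I S \<and> X = submodule_sum M I S"


section \<open>Chain complexes, vector fields and their flows\<close>

text \<open>All modules of a complex have their carriers in one type. This is no restriction, since any
  family of modules can be realised inside a disjoint union.\<close>

locale chain_complex =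
  fixes R :: "('r, 's) ring_scheme" and F :: "int \<Rightarrow> ('r, 'm) module" and \<phi> :: "int \<Rightarrow> 'm \<Rightarrow> 'm"
  assumes left_module: "left_module R (F n)"
    and boundary_hom: "\<phi> n \<in> module_hom R (F n) (F (n - 1))"
    and boundary_boundary: "x \<in> carrier (F n) \<Longrightarrow> \<phi> (n - 1) (\<phi> n x) = \<zero>\<^bsub>F (n - 2)\<^esub>"

definition chain_homotopy ::
  "('r, 's) ring_scheme \<Rightarrow> (int \<Rightarrow> ('r, 'm) module) \<Rightarrow> (int \<Rightarrow> 'm \<Rightarrow> 'm) \<Rightarrow> bool"
  where "chain_homotopy R F D \<longleftrightarrow> (\<forall>n. D n \<in> module_hom R (F n) (F (n + 1)))"

definition vector_field ::
  "('r, 's) ring_scheme \<Rightarrow> (int \<Rightarrow> ('r, 'm) module) \<Rightarrow> (int \<Rightarrow> 'm \<Rightarrow> 'm) \<Rightarrow> bool"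
  where "vector_field R F V \<longleftrightarrow> chain_homotopy R F V
    \<and> (\<forall>n. \<forall>x\<in>carrier (F n). V (n + 1) (V n x) = \<zero>\<^bsub>F (n + 2)\<^esub>)"

definition flow ::
  "(int \<Rightarrow> ('r, 'm) module) \<Rightarrow> (int \<Rightarrow> 'm \<Rightarrow> 'm) \<Rightarrow> (int \<Rightarrow> 'm \<Rightarrow> 'm) \<Rightarrow> int \<Rightarrow> 'm \<Rightarrow> 'm"
  where "flow F \<phi> D n x = x \<ominus>\<^bsub>F n\<^esub> \<phi> (n + 1) (D n x) \<ominus>\<^bsub>F n\<^esub> D (n - 1) (\<phi> n x)"

definition partial_splitting ::
  "('r, 's) ring_scheme \<Rightarrow> (int \<Rightarrow> ('r, 'm) module) \<Rightarrow> (int \<Rightarrow> 'm \<Rightarrow> 'm) \<Rightarrow> (int \<Rightarrow> 'm \<Rightarrow> 'm) \<Rightarrow> bool"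
  where "partial_splitting R F \<phi> D \<longleftrightarrow> vector_field R F D
    \<and> (\<forall>n. \<forall>x\<in>carrier (F n). D n (\<phi> (n + 1) (D n x)) = D n x)"

text \<open>The summands of \<open>F\<^sub>n\<close>. Note that \<open>part_N F \<phi> D n\<close>, the image of \<open>\<phi>D\<close> in degree \<open>n\<close>, is
  the module conventionally written with index \<open>n + 1\<close>.\<close>

definition part_N ::
  "(int \<Rightarrow> ('r, 'm) module) \<Rightarrow> (int \<Rightarrow> 'm \<Rightarrow> 'm) \<Rightarrow> (int \<Rightarrow> 'm \<Rightarrow> 'm) \<Rightarrow> int \<Rightarrow> 'm set"
  where "part_N F \<phi> D n = (\<lambda>x. \<phi> (n + 1) (D n x)) ` carrier (F n)"

definition part_M ::
  "(int \<Rightarrow> ('r, 'm) module) \<Rightarrow> (int \<Rightarrow> 'm \<Rightarrow> 'm) \<Rightarrow> (int \<Rightarrow> 'm \<Rightarrow> 'm) \<Rightarrow> int \<Rightarrow> 'm set"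
  where "part_M F \<phi> D n = (\<lambda>x. D (n - 1) (\<phi> n x)) ` carrier (F n)"

definition part_C ::
  "(int \<Rightarrow> ('r, 'm) module) \<Rightarrow> (int \<Rightarrow> 'm \<Rightarrow> 'm) \<Rightarrow> (int \<Rightarrow> 'm \<Rightarrow> 'm) \<Rightarrow> int \<Rightarrow> 'm set"
  where "part_C F \<phi> D n =
    {x \<in> carrier (F n). D (n - 1) (\<phi> n x) = \<zero>\<^bsub>F n\<^esub> \<and> \<phi> (n + 1) (D n x) = \<zero>\<^bsub>F n\<^esub>}"


section \<open>Gradings by a poset\<close>

text \<open>\<open>G n a\<close> is the summand \<open>F\<^sub>n\<^sup>a\<close>, and \<open>lower F G a n\<close> is \<open>F\<^sub>n(a)\<close>.\<close>

definition lower ::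
  "(int \<Rightarrow> ('r, 'm) module) \<Rightarrow> (int \<Rightarrow> 'p::order \<Rightarrow> 'm set) \<Rightarrow> 'p \<Rightarrow> int \<Rightarrow> 'm set"
  where "lower F G a n = submodule_sum (F n) {x. x \<le> a} (G n)"

definition grading ::
  "('r, 's) ring_scheme \<Rightarrow> (int \<Rightarrow> ('r, 'm) module) \<Rightarrow> (int \<Rightarrow> 'm \<Rightarrow> 'm)
    \<Rightarrow> (int \<Rightarrow> 'p::order \<Rightarrow> 'm set) \<Rightarrow> bool"
  where "grading R F \<phi> G \<longleftrightarrow>
    (\<forall>n a. submodule (G n a) R (F n))
    \<and> (\<forall>n. is_direct_sum (F n) (carrier (F n)) UNIV (G n))
    \<and> (\<forall>n a. \<phi> n ` lower F G a n \<subseteq> lower F G a (n - 1))"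

text \<open>The degree \<open>n\<close> part of the complex by which \<open>F(a)\<close> is divided to form the stratum at \<open>a\<close>.\<close>

definition strictly_lower ::
  "(int \<Rightarrow> ('r, 'm) module) \<Rightarrow> (int \<Rightarrow> 'p::order \<Rightarrow> 'm set) \<Rightarrow> 'p \<Rightarrow> int \<Rightarrow> 'm set"
  where "strictly_lower F G a n = submodule_sum (F n) {b. b < a} (\<lambda>b. lower F G b n)"

text \<open>The stratum at \<open>a\<close> is the quotient complex of \<open>F(a)\<close> by \<^const>\<open>strictly_lower\<close>, where
  \<open>F\<^sub>n\<^sup>a\<close> is identified with the quotient in degree \<open>n\<close> by sending \<open>x\<close> to its coset; thus
  its boundary takes \<open>x\<close> to the element of \<open>F\<^sub>n\<^sub>-\<^sub>1\<^sup>a\<close> which represents the coset of \<open>\<phi> x\<close>.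
  See \<open>stratum_identification\<close> and \<open>stratum_boundary_coset\<close> below.\<close>

definition stratum ::
  "(int \<Rightarrow> ('r, 'm) module) \<Rightarrow> (int \<Rightarrow> 'p::order \<Rightarrow> 'm set) \<Rightarrow> 'p \<Rightarrow> int \<Rightarrow> ('r, 'm) module"
  where "stratum F G a n = (F n)\<lparr>carrier := G n a\<rparr>"

definition stratum_boundary ::
  "(int \<Rightarrow> ('r, 'm) module) \<Rightarrow> (int \<Rightarrow> 'm \<Rightarrow> 'm) \<Rightarrow> (int \<Rightarrow> 'p::order \<Rightarrow> 'm set)
    \<Rightarrow> 'p \<Rightarrow> int \<Rightarrow> 'm \<Rightarrow> 'm"
  where "stratum_boundary F \<phi> G a n x =
    (THE y. y \<in> G (n - 1) a
      \<and> strictly_lower F G a (n - 1) +>\<^bsub>F (n - 1)\<^esub> y = strictly_lower F G a (n - 1) +>\<^bsub>F (n - 1)\<^esub> \<phi> n x)"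

definition component ::
  "(int \<Rightarrow> ('r, 'm) module) \<Rightarrow> (int \<Rightarrow> 'p::order \<Rightarrow> 'm set) \<Rightarrow> 'p \<Rightarrow> int \<Rightarrow> 'm \<Rightarrow> 'm"
  where "component F G c n x =
    (THE y. y \<in> G n c \<and> (\<exists>z\<in>submodule_sum (F n) {b. b \<noteq> c} (G n). x = y \<oplus>\<^bsub>F n\<^esub> z))"

definition induced_field ::
  "(int \<Rightarrow> ('r, 'm) module) \<Rightarrow> (int \<Rightarrow> 'p::order \<Rightarrow> 'm set) \<Rightarrow> ('p \<Rightarrow> int \<Rightarrow> 'm \<Rightarrow> 'm)
    \<Rightarrow> int \<Rightarrow> 'm \<Rightarrow> 'm"
  where "induced_field F G V n x =
    (\<Oplus>\<^bsub>F (n + 1)\<^esub>c\<in>{c. component F G c n x \<noteq> \<zero>\<^bsub>F n\<^esub>}. V c n (component F G c n x))"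

definition grading_support ::
  "(int \<Rightarrow> ('r, 'm) module) \<Rightarrow> (int \<Rightarrow> 'p::order \<Rightarrow> 'm set) \<Rightarrow> int \<Rightarrow> 'p set"
  where "grading_support F G n = {c. G n c \<noteq> {\<zero>\<^bsub>F n\<^esub>}}"

definition poset_dim :: "'p::order set \<Rightarrow> 'p \<Rightarrow> enat"
  where "poset_dim P a =
    Sup {enat n | n. \<exists>f :: nat \<Rightarrow> 'p. (\<forall>i\<le>n. f i \<in> P) \<and> (\<forall>i<n. f i < f (Suc i)) \<and> f n = a}"


section \<open>Correctness of the stratum and of the induced vector field\<close>

lemma submodule_sum_mono: "I \<subseteq> J \<Longrightarrow> submodule_sum M I S \<subseteq> submodule_sum M J S"
  unfolding submodule_sum_def by blast

lemma (in abelian_group) add_minus_cancel: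
  assumes "x \<in> carrier G" "y \<in> carrier G"
  shows "(y \<oplus> x) \<ominus> y = x"
  using assms by (simp add: a_minus_def a_comm[of y x] a_assoc r_neg)

lemma (in abelian_group) minus_eq_zeroD:
  assumes "x \<ominus> y = \<zero>" "x \<in> carrier G" "y \<in> carrier G"
  shows "x = y"
proof -
  have "x = (x \<ominus> y) \<oplus> y" using assms(2,3) by (simp add: a_minus_def a_assoc l_neg)
  then show ?thesis using assms by simp
qed

lemma (in abelian_group) family_carrier:
  assumes "\<And>i. i \<in> I \<Longrightarrow> additive_subgroup (S i) G" "J \<subseteq> I" "f \<in> Pi J S"
  shows "f \<in> J \<rightarrow> carrier G"
proof
  fix i assume "i \<in> J"
  then have "f i \<in> S i" "additive_subgroup (S i) G" using assms by auto
  then show "f i \<in> carrier G" by (rule subsetD[OF additive_subgroup.a_subset, rotated])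
qed

lemma (in abelian_group) submodule_sum_carrier:
  assumes "\<And>i. i \<in> I \<Longrightarrow> S i \<subseteq> carrier G"
  shows "submodule_sum G I S \<subseteq> carrier G"
proof
  fix x assume "x \<in> submodule_sum G I S"
  then obtain J f where *: "J \<subseteq> I" "f \<in> Pi J S" "x = finsum G f J"
    unfolding submodule_sum_def by blast
  have "f \<in> J \<rightarrow> carrier G" using * assms by (auto simp: Pi_def)
  then show "x \<in> carrier G" using * by (simp add: finsum_closed)
qed

lemma (in abelian_group) submodule_sum_memI:
  assumes "i \<in> I" "x \<in> S i" "S i \<subseteq> carrier G"
  shows "x \<in> submodule_sum G I S"
proof -
  have "x = finsum G (\<lambda>_. x) {i}"
    using assms by (subst finsum_insert) auto
  then show ?thesis using assms unfolding submodule_sum_def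
    by (intro CollectI exI[of _ "{i}"] exI[of _ "\<lambda>_. x"]) auto
qed

text \<open>A finite subset of the index set may be enlarged, using the zero element.\<close>

lemma (in abelian_group) finsum_extend:
  assumes "finite J" "J' \<subseteq> J" "f \<in> J' \<rightarrow> carrier G"
  shows "finsum G f J' = finsum G (\<lambda>i. if i \<in> J' then f i else \<zero>) J"
proof -
  have "finsum G (\<lambda>i. if i \<in> J' then f i else \<zero>) J = finsum G (\<lambda>i. if i \<in> J' then f i else \<zero>) J'"
    using assms by (intro add.finprod_mono_neutral_cong_right) (auto simp: Pi_def)
  also have "\<dots> = finsum G f J'"
    using assms by (intro finsum_cong') auto
  finally show ?thesis by simp
qed

lemma (in abelian_group) submodule_sum_add:
  assumes S: "\<And>i. i \<in> I \<Longrightarrow> additive_subgroup (S i) G"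
    and "x \<in> submodule_sum G I S" "y \<in> submodule_sum G I S"
  shows "x \<oplus> y \<in> submodule_sum G I S"
proof -
  obtain J f where J: "finite J" "J \<subseteq> I" "f \<in> Pi J S" "x = finsum G f J"
    using assms unfolding submodule_sum_def by blast
  obtain K g where K: "finite K" "K \<subseteq> I" "g \<in> Pi K S" "y = finsum G g K"
    using assms unfolding submodule_sum_def by blast
  let ?f = "\<lambda>i. if i \<in> J then f i else \<zero>" and ?g = "\<lambda>i. if i \<in> K then g i else \<zero>"
  have f: "?f \<in> Pi (J \<union> K) S" and g: "?g \<in> Pi (J \<union> K) S"
    using J K S by (auto simp: Pi_def additive_subgroup.zero_closed subset_iff)
  have JK: "J \<union> K \<subseteq> I" using J K by auto
  have fc: "?f \<in> J \<union> K \<rightarrow> carrier G" and gc: "?g \<in> J \<union> K \<rightarrow> carrier G"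
    using family_carrier[OF S JK f] family_carrier[OF S JK g] by simp_all
  have fc': "f \<in> J \<rightarrow> carrier G" and gc': "g \<in> K \<rightarrow> carrier G"
    using family_carrier[OF S J(2,3)] family_carrier[OF S K(2,3)] by simp_all
  have "x = finsum G ?f (J \<union> K)"
    unfolding J(4) using J K fc' by (intro finsum_extend) auto
  moreover have "y = finsum G ?g (J \<union> K)"
    unfolding K(4) using J K gc' by (intro finsum_extend) auto
  ultimately have "x \<oplus> y = finsum G (\<lambda>i. ?f i \<oplus> ?g i) (J \<union> K)"
    using fc gc by (simp add: finsum_addf)
  moreover have "(\<lambda>i. ?f i \<oplus> ?g i) \<in> Pi (J \<union> K) S"
    using f g J(2) K(2) S by (intro Pi_I additive_subgroup.a_closed) (auto simp: Pi_def)
  ultimately show ?thesis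
    unfolding submodule_sum_def using J K
    by (intro CollectI exI[of _ "J \<union> K"] exI[of _ "\<lambda>i. ?f i \<oplus> ?g i"]) auto
qed

lemma (in abelian_group) submodule_sum_zero: "\<zero> \<in> submodule_sum G I S"
  unfolding submodule_sum_def by (auto intro!: exI[of _ "{}"])

lemma (in abelian_group) finsum_a_inv:
  assumes "finite J" "f \<in> J \<rightarrow> carrier G"
  shows "\<ominus> (finsum G f J) = finsum G (\<lambda>i. \<ominus> f i) J"
  using assms by (induction J) (auto simp: Pi_def minus_add)

lemma (in abelian_group) submodule_sum_minus:
  assumes S: "\<And>i. i \<in> I \<Longrightarrow> additive_subgroup (S i) G"
    and "x \<in> submodule_sum G I S"
  shows "\<ominus> x \<in> submodule_sum G I S"
proof -
  obtain J f where J: "finite J" "J \<subseteq> I" "f \<in> Pi J S" "x = finsum G f J"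
    using assms unfolding submodule_sum_def by blast
  have "f \<in> J \<rightarrow> carrier G"
    using family_carrier[OF S J(2,3)] by simp
  then have "\<ominus> x = finsum G (\<lambda>i. \<ominus> f i) J" using J by (simp add: finsum_a_inv)
  moreover have "(\<lambda>i. \<ominus> f i) \<in> Pi J S"
    using J S by (intro Pi_I additive_subgroup.a_inv_closed) (auto simp: Pi_def)
  ultimately show ?thesis unfolding submodule_sum_def using J
    by (intro CollectI exI[of _ J] exI[of _ "\<lambda>i. \<ominus> f i"]) auto
qed

lemma (in abelian_group) submodule_sum_subgroup:
  assumes S: "\<And>i. i \<in> I \<Longrightarrow> additive_subgroup (S i) G"
  shows "additive_subgroup (submodule_sum G I S) G"
proof (intro additive_subgroupI add.subgroupI)
  show "submodule_sum G I S \<subseteq> carrier G"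
    using S by (intro submodule_sum_carrier) (simp add: additive_subgroup.a_subset)
  show "submodule_sum G I S \<noteq> {}" using submodule_sum_zero by blast
qed (use submodule_sum_add[OF S] submodule_sum_minus[OF S] in \<open>auto simp: a_inv_def\<close>)

lemma (in abelian_group) submodule_sum_insert:
  assumes S: "\<And>j. j \<in> insert i I \<Longrightarrow> additive_subgroup (S j) G"
    and "x \<in> submodule_sum G (insert i I) S"
  shows "\<exists>y\<in>S i. \<exists>z\<in>submodule_sum G (I - {i}) S. x = y \<oplus> z"
proof -
  obtain J f where J: "finite J" "J \<subseteq> insert i I" "f \<in> Pi J S" "x = finsum G f J"
    using assms unfolding submodule_sum_def by blast
  have fc: "f \<in> J \<rightarrow> carrier G"
    using family_carrier[OF S J(2,3)] by simp
  have z: "finsum G f (J - {i}) \<in> submodule_sum G (I - {i}) S"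
    unfolding submodule_sum_def using J by (intro CollectI exI[of _ "J - {i}"] exI[of _ f]) auto
  have zc: "finsum G f (J - {i}) \<in> carrier G" using fc by (intro finsum_closed) auto
  show ?thesis
  proof (cases "i \<in> J")
    case True
    then have "x = finsum G f (insert i (J - {i}))" using J by (simp add: insert_absorb)
    also have "\<dots> = f i \<oplus> finsum G f (J - {i})"
      using J fc True by (intro finsum_insert) auto
    finally show ?thesis using z J True by blast
  next
    case False
    then have "x = \<zero> \<oplus> finsum G f (J - {i})" using J zc by simp
    then show ?thesis using z S[of i] by (auto dest: additive_subgroup.zero_closed)
  qed
qed

lemma (in abelian_group) direct_disjoint:
  assumes S: "\<And>j. j \<in> I \<Longrightarrow> additive_subgroup (S j) G"
    and d: "direct G I S" and i: "i \<in> I" "J \<subseteq> I" "i \<notin> J"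
    and x: "x \<in> S i" "x \<in> submodule_sum G J S"
  shows "x = \<zero>"
proof -
  obtain K f where K: "finite K" "K \<subseteq> J" "f \<in> Pi K S" "x = finsum G f K"
    using x unfolding submodule_sum_def by blast
  have iK: "i \<notin> K" using K i by blast
  have fc: "f \<in> K \<rightarrow> carrier G"
    using family_carrier[OF S subset_trans[OF K(2) i(2)] K(3)] by simp
  have xc: "x \<in> carrier G" using S[OF i(1)] x(1) by (auto dest: additive_subgroup.a_subset)
  let ?g = "\<lambda>j. if j = i then \<ominus> x else f j"
  have "finsum G ?g (insert i K) = ?g i \<oplus> finsum G ?g K"
    using K fc xc iK by (intro finsum_insert) (auto simp: Pi_def)
  also have "finsum G ?g K = finsum G f K"
    using fc iK by (intro finsum_cong') (auto simp: Pi_def)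
  also have "?g i \<oplus> finsum G f K = \<zero>" using K xc by (simp add: l_neg)
  finally have "finsum G ?g (insert i K) = \<zero>" .
  moreover have "?g \<in> Pi (insert i K) S"
    using K x(1) S[OF i(1)] iK by (auto simp: Pi_def intro: additive_subgroup.a_inv_closed)
  moreover have "finite (insert i K)" "insert i K \<subseteq> I" using K i by auto
  ultimately have "?g i = \<zero>" using d unfolding direct_def by blast
  then have "\<ominus> x = \<zero>" by simp
  moreover have "x = \<ominus> (\<ominus> x)" using xc by simp
  ultimately show ?thesis by simp
qed

locale graded_complex = chain_complex R F \<phi>
  for R :: "('r, 's) ring_scheme" and F :: "int \<Rightarrow> ('r, 'm) module" and \<phi> +
  fixes G :: "int \<Rightarrow> 'p::order \<Rightarrow> 'm set"
  assumes grading: "grading R F \<phi> G"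
begin

lemma F_abelian_group: "abelian_group (F n)"
  using left_module[of n] by (simp add: left_module_def)

lemma G_subgroup: "additive_subgroup (G n a) (F n)"
  using grading by (auto simp: grading_def submodule_def intro: additive_subgroupI)

lemma G_carrier: "G n a \<subseteq> carrier (F n)"
  using G_subgroup additive_subgroup.a_subset by blast

lemma G_direct: "direct (F n) UNIV (G n)"
  and carrier_eq: "carrier (F n) = submodule_sum (F n) UNIV (G n)"
  using grading by (auto simp: grading_def is_direct_sum_def)

lemma G_lower:
  assumes "x \<in> G n a"
  shows "x \<in> lower F G a n"
  unfolding lower_def
  by (rule abelian_group.submodule_sum_memI[where S = "G n", OF F_abelian_group _ assms G_carrier]) simp

lemma strictly_lower_eq: "strictly_lower F G a n = submodule_sum (F n) {b. b < a} (G n)"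
proof -
  interpret abelian_group "F n" by (rule F_abelian_group)
  have low: "additive_subgroup (lower F G b n) (F n)" for b
    unfolding lower_def by (intro submodule_sum_subgroup G_subgroup)
  have sub: "additive_subgroup (submodule_sum (F n) {b. b < a} (G n)) (F n)"
    by (intro submodule_sum_subgroup G_subgroup)
  show ?thesis
  proof (intro equalityI subsetI)
    fix x assume "x \<in> strictly_lower F G a n"
    then obtain J f where J: "finite J" "J \<subseteq> {b. b < a}" "f \<in> Pi J (\<lambda>b. lower F G b n)"
      "x = finsum (F n) f J"
      unfolding strictly_lower_def submodule_sum_def by blast
    have "f \<in> J \<rightarrow> submodule_sum (F n) {b. b < a} (G n)"
    proof
      fix j assume "j \<in> J"
      then have "f j \<in> lower F G j n" "{x. x \<le> j} \<subseteq> {b. b < a}" using J by auto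
      then show "f j \<in> submodule_sum (F n) {b. b < a} (G n)"
        unfolding lower_def by (meson submodule_sum_mono subsetD)
    qed
    with J(1) have "finsum (F n) f J \<in> submodule_sum (F n) {b. b < a} (G n)"
    proof (induction J)
      case empty
      then show ?case by (simp add: submodule_sum_zero)
    next
      case (insert j J)
      then have "f \<in> insert j J \<rightarrow> carrier (F n)"
        using additive_subgroup.a_subset[OF sub] by (auto simp: Pi_def)
      then have "finsum (F n) f (insert j J) = f j \<oplus>\<^bsub>F n\<^esub> finsum (F n) f J"
        using insert.hyps by (intro finsum_insert) auto
      with insert show ?case by (auto intro!: additive_subgroup.a_closed[OF sub])
    qed
    then show "x \<in> submodule_sum (F n) {b. b < a} (G n)" using J by simp
  next
    fix x assume "x \<in> submodule_sum (F n) {b. b < a} (G n)"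
    then obtain J f where J: "finite J" "J \<subseteq> {b. b < a}" "f \<in> Pi J (G n)" "x = finsum (F n) f J"
      unfolding submodule_sum_def by blast
    have "f \<in> Pi J (\<lambda>b. lower F G b n)"
    proof
      fix j assume "j \<in> J"
      then have "f j \<in> G n j" using J by auto
      then show "f j \<in> lower F G j n" by (rule G_lower)
    qed
    then show "x \<in> strictly_lower F G a n"
      unfolding strictly_lower_def submodule_sum_def using J by blast
  qed
qed

lemma strictly_lower_subgroup: "additive_subgroup (strictly_lower F G a n) (F n)"
  unfolding strictly_lower_eq
  by (intro abelian_group.submodule_sum_subgroup F_abelian_group G_subgroup)

lemma strictly_lower_subset: "strictly_lower F G a n \<subseteq> lower F G a n"
  unfolding strictly_lower_eq lower_def by (intro submodule_sum_mono) auto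

lemma lower_coset_eq_iff:
  assumes "x \<in> carrier (F n)" "y \<in> carrier (F n)"
  shows "strictly_lower F G a n +>\<^bsub>F n\<^esub> x = strictly_lower F G a n +>\<^bsub>F n\<^esub> y
    \<longleftrightarrow> x \<ominus>\<^bsub>F n\<^esub> y \<in> strictly_lower F G a n"
proof -
  interpret abelian_group "F n" by (rule F_abelian_group)
  let ?L = "strictly_lower F G a n"
  have L: "?L \<subseteq> carrier (F n)" "subgroup ?L (add_monoid (F n))"
    using strictly_lower_subgroup[of a n]
    by (auto dest: additive_subgroup.a_subset additive_subgroup.a_subgroup)
  have c: "x \<oplus>\<^bsub>F n\<^esub> \<ominus>\<^bsub>F n\<^esub> y \<in> carrier (F n)" using assms by simp
  show ?thesis
    unfolding a_minus_def
  proof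
    assume "?L +>\<^bsub>F n\<^esub> x = ?L +>\<^bsub>F n\<^esub> y"
    then show "x \<oplus>\<^bsub>F n\<^esub> \<ominus>\<^bsub>F n\<^esub> y \<in> ?L"
      by (rule a_coset_join1[OF a_coset_add_inv2[OF _ assms L(1)] c L(2)])
  next
    assume "x \<oplus>\<^bsub>F n\<^esub> \<ominus>\<^bsub>F n\<^esub> y \<in> ?L"
    then show "?L +>\<^bsub>F n\<^esub> x = ?L +>\<^bsub>F n\<^esub> y"
      by (rule a_coset_add_inv1[OF a_coset_join2[OF c L(2)] assms L(1)])
  qed
qed

text \<open>The map \<open>F\<^sub>n\<^sup>a \<rightarrow> F(a)\<^sub>n / (\<Sum>b<a. F(b)\<^sub>n)\<close> taking cosets is bijective. It is clearly linear.\<close>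

theorem stratum_identification:
  "bij_betw (\<lambda>x. strictly_lower F G a n +>\<^bsub>F n\<^esub> x) (G n a)
    ((\<lambda>x. strictly_lower F G a n +>\<^bsub>F n\<^esub> x) ` lower F G a n)"
proof -
  interpret abelian_group "F n" by (rule F_abelian_group)
  let ?c = "\<lambda>x. strictly_lower F G a n +>\<^bsub>F n\<^esub> x"
  have "inj_on ?c (G n a)"
  proof
    fix x y assume xy: "x \<in> G n a" "y \<in> G n a" "?c x = ?c y"
    then have c: "x \<in> carrier (F n)" "y \<in> carrier (F n)" using G_carrier by auto
    have "x \<ominus>\<^bsub>F n\<^esub> y \<in> submodule_sum (F n) {b. b < a} (G n)"
      using lower_coset_eq_iff[OF c] xy by (simp add: strictly_lower_eq)
    moreover have "x \<ominus>\<^bsub>F n\<^esub> y \<in> G n a"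
      unfolding a_minus_def using xy G_subgroup
      by (simp add: additive_subgroup.a_closed additive_subgroup.a_inv_closed)
    ultimately have "x \<ominus>\<^bsub>F n\<^esub> y = \<zero>\<^bsub>F n\<^esub>"
      by (intro direct_disjoint[OF G_subgroup G_direct, of a "{b. b < a}"]) auto
    then show "x = y" using c by (rule minus_eq_zeroD)
  qed
  moreover have "?c ` lower F G a n = ?c ` G n a"
  proof (intro equalityI subsetI)
    fix X assume "X \<in> ?c ` lower F G a n"
    then obtain x where x: "x \<in> lower F G a n" "X = ?c x" by blast
    have ins: "{x. x \<le> a} = insert a {b. b < a}" by auto
    obtain y z where yz: "y \<in> G n a" "z \<in> submodule_sum (F n) ({b. b < a} - {a}) (G n)" "x = y \<oplus>\<^bsub>F n\<^esub> z"
      using x submodule_sum_insert[of a "{b. b < a}" "G n" x] G_subgroup unfolding lower_def ins by blast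
    have z: "z \<in> strictly_lower F G a n"
      using yz unfolding strictly_lower_eq by (auto intro: subsetD[OF submodule_sum_mono])
    then have zc: "z \<in> carrier (F n)"
      using additive_subgroup.a_subset[OF strictly_lower_subgroup] by blast
    have yc: "y \<in> carrier (F n)" using yz G_carrier by auto
    have "x \<ominus>\<^bsub>F n\<^esub> y = z" using yc zc yz by (simp add: add_minus_cancel)
    then have "X = ?c y"
      using x yz yc zc z by (subst x(2), subst lower_coset_eq_iff) auto
    then show "X \<in> ?c ` G n a" using yz by blast
  next
    fix X assume "X \<in> ?c ` G n a"
    then show "X \<in> ?c ` lower F G a n" using G_lower by blast
  qed
  ultimately show ?thesis by (simp add: bij_betw_def)
qed

theorem stratum_boundary_coset:
  assumes "x \<in> G n a"
  shows "stratum_boundary F \<phi> G a n x \<in> G (n - 1) a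
    \<and> strictly_lower F G a (n - 1) +>\<^bsub>F (n - 1)\<^esub> stratum_boundary F \<phi> G a n x
      = strictly_lower F G a (n - 1) +>\<^bsub>F (n - 1)\<^esub> \<phi> n x"
  unfolding stratum_boundary_def
proof (rule theI')
  have "x \<in> lower F G a n" using assms by (rule G_lower)
  then have \<phi>x: "\<phi> n x \<in> lower F G a (n - 1)"
    using grading unfolding grading_def by blast
  let ?c = "\<lambda>y. strictly_lower F G a (n - 1) +>\<^bsub>F (n - 1)\<^esub> y"
  have inj: "inj_on ?c (G (n - 1) a)" and im: "?c ` G (n - 1) a = ?c ` lower F G a (n - 1)"
    using stratum_identification[of "n - 1" a] unfolding bij_betw_def by simp_all
  have "?c (\<phi> n x) \<in> ?c ` G (n - 1) a" unfolding im using \<phi>x by (rule imageI)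
  then obtain y where y: "y \<in> G (n - 1) a" "?c y = ?c (\<phi> n x)" by (metis imageE)
  show "\<exists>!y. y \<in> G (n - 1) a \<and> ?c y = ?c (\<phi> n x)"
  proof (rule ex1I[of _ y])
    fix y' assume "y' \<in> G (n - 1) a \<and> ?c y' = ?c (\<phi> n x)"
    then show "y' = y" using inj_onD[OF inj, of y' y] y by simp
  qed (use y in simp)
qed

lemma component_unique:
  assumes "x \<in> carrier (F n)"
  shows "\<exists>!y. y \<in> G n c \<and> (\<exists>z\<in>submodule_sum (F n) {b. b \<noteq> c} (G n). x = y \<oplus>\<^bsub>F n\<^esub> z)"
proof -
  interpret abelian_group "F n" by (rule F_abelian_group)
  let ?S = "submodule_sum (F n) {b. b \<noteq> c} (G n)"
  have S: "additive_subgroup ?S (F n)" by (intro submodule_sum_subgroup G_subgroup)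
  have eq: "insert c UNIV = UNIV" "UNIV - {c} = {b. b \<noteq> c}" by auto
  obtain y z where yz: "y \<in> G n c" "z \<in> ?S" "x = y \<oplus>\<^bsub>F n\<^esub> z"
    using submodule_sum_insert[of c UNIV "G n" x] G_subgroup assms carrier_eq unfolding eq by blast
  show ?thesis
  proof (rule ex1I[of _ y])
    show "y \<in> G n c \<and> (\<exists>z\<in>?S. x = y \<oplus>\<^bsub>F n\<^esub> z)" using yz by blast
    fix y' assume "y' \<in> G n c \<and> (\<exists>z\<in>?S. x = y' \<oplus>\<^bsub>F n\<^esub> z)"
    then obtain z' where z': "y' \<in> G n c" "z' \<in> ?S" "x = y' \<oplus>\<^bsub>F n\<^esub> z'" by blast
    have c: "y \<in> carrier (F n)" "y' \<in> carrier (F n)" "z \<in> carrier (F n)" "z' \<in> carrier (F n)"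
      using yz z' G_carrier additive_subgroup.a_subset[OF S] by auto
    have "y' \<ominus>\<^bsub>F n\<^esub> y = ((y' \<oplus>\<^bsub>F n\<^esub> z') \<ominus>\<^bsub>F n\<^esub> z') \<ominus>\<^bsub>F n\<^esub> y"
      using c by (simp add: a_minus_def a_assoc r_neg)
    also have "y' \<oplus>\<^bsub>F n\<^esub> z' = y \<oplus>\<^bsub>F n\<^esub> z" using yz z' by simp
    also have "((y \<oplus>\<^bsub>F n\<^esub> z) \<ominus>\<^bsub>F n\<^esub> z') \<ominus>\<^bsub>F n\<^esub> y = z \<ominus>\<^bsub>F n\<^esub> z'"
      using c add_minus_cancel[of "z \<ominus>\<^bsub>F n\<^esub> z'" y] by (simp add: a_minus_def a_assoc)
    finally have "y' \<ominus>\<^bsub>F n\<^esub> y = z \<ominus>\<^bsub>F n\<^esub> z'" .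
    moreover have "z \<ominus>\<^bsub>F n\<^esub> z' \<in> ?S" unfolding a_minus_def
      using yz z' S by (simp add: additive_subgroup.a_closed additive_subgroup.a_inv_closed)
    moreover have "y' \<ominus>\<^bsub>F n\<^esub> y \<in> G n c" unfolding a_minus_def
      using yz z' G_subgroup by (simp add: additive_subgroup.a_closed additive_subgroup.a_inv_closed)
    ultimately have "y' \<ominus>\<^bsub>F n\<^esub> y = \<zero>\<^bsub>F n\<^esub>"
      by (intro direct_disjoint[OF G_subgroup G_direct, of c "{b. b \<noteq> c}"]) auto
    then show "y' = y" using c(2,1) by (rule minus_eq_zeroD)
  qed
qed

lemma component_homogeneous:
  assumes "x \<in> G n c"
  shows "component F G b n x = (if b = c then x else \<zero>\<^bsub>F n\<^esub>)"
proof -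
  interpret abelian_group "F n" by (rule F_abelian_group)
  have xc: "x \<in> carrier (F n)" using assms G_carrier by auto
  have "(if b = c then x else \<zero>\<^bsub>F n\<^esub>) \<in> G n b"
    using assms G_subgroup by (simp add: additive_subgroup.zero_closed)
  moreover have "\<exists>z\<in>submodule_sum (F n) {b'. b' \<noteq> b} (G n). x = (if b = c then x else \<zero>\<^bsub>F n\<^esub>) \<oplus>\<^bsub>F n\<^esub> z"
  proof (cases "b = c")
    case True
    then show ?thesis using xc submodule_sum_zero by (intro bexI[of _ "\<zero>\<^bsub>F n\<^esub>"]) auto
  next
    case False
    then show ?thesis using xc assms G_carrier by (intro bexI[of _ x] submodule_sum_memI[of c]) auto
  qed
  ultimately show ?thesis
    unfolding component_def using component_unique[OF xc, of b] by (intro the1_equality) auto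
qed

theorem induced_field_homogeneous:
  assumes V: "vector_field R (stratum F G c) (V c)" and x: "x \<in> G n c"
  shows "induced_field F G V n x = V c n x"
proof -
  interpret abelian_group "F n" by (rule F_abelian_group)
  interpret F': abelian_group "F (n + 1)" by (rule F_abelian_group)
  have hom: "V c n \<in> module_hom R (stratum F G c n) (stratum F G c (n + 1))"
    using V by (simp add: vector_field_def chain_homotopy_def)
  have Vx: "V c n y \<in> G (n + 1) c" if "y \<in> G n c" for y
    using hom that by (auto simp: module_hom_def stratum_def)
  show ?thesis
  proof (cases "x = \<zero>\<^bsub>F n\<^esub>")
    case True
    have "V c n (x \<oplus>\<^bsub>F n\<^esub> x) = V c n x \<oplus>\<^bsub>F (n + 1)\<^esub> V c n x"
      using hom x by (auto simp: module_hom_def stratum_def)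
    then have "V c n x = \<zero>\<^bsub>F (n + 1)\<^esub>"
      using True Vx[OF x] G_carrier[of "n + 1" c] by (auto simp: subset_iff)
    moreover have "{b. component F G b n x \<noteq> \<zero>\<^bsub>F n\<^esub>} = {}"
      using component_homogeneous[OF x] True by auto
    ultimately show ?thesis unfolding induced_field_def by simp
  next
    case False
    then have "{b. component F G b n x \<noteq> \<zero>\<^bsub>F n\<^esub>} = {c}"
      using component_homogeneous[OF x] by auto
    then show ?thesis unfolding induced_field_def
      using Vx[OF x] G_carrier[of "n + 1" c] component_homogeneous[OF x] by (auto simp: subset_iff)
  qed
qed

end

end

theory Submission
  imports Defs
begin

text \<open>On \<open>F\<^sub>n\<^sup>c\<close> the boundary is the boundary of the stratum up to terms from strata below \<open>c\<close>, and
  \<open>V\<close> respects the strata. Hence \<open>\<Phi>\<close> maps \<open>M\<^sup>c\<close> into \<open>\<Oplus>b<c. M\<^sup>b\<close>, moves the elements of \<open>C\<^sup>c\<close> by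
  elements of \<open>\<Oplus>b<c. M\<^sup>b\<close>, and maps \<open>N\<^sup>c\<close> into \<open>\<Oplus>b<c. F\<^sub>n\<^sup>b\<close>. Each application of \<open>\<Phi>\<close> to \<open>M\<close> or \<open>N\<close>
  thus lowers the dimension of the index, so after more than \<open>d(a)\<close> steps only the eventually
  constant orbits of the elements of \<open>C\<close> remain. Since \<open>\<Phi>\<^sup>k\<close> does not change the leading term of an
  element of \<open>C\<^sup>c\<close>, the images of these summands remain independent.\<close>

section \<open>Sums of subgroups and homomorphisms\<close>

text \<open>The summands behave differently for one reason. On \<open>F_n^c\<close>,
  \<open>\<Phi> x\<close> differs from the flow of the stratum by two corrections: the part of
  \<open>\<phi> (W x)\<close> below \<open>c\<close>, where \<open>W\<close> is the induced field,
  and \<open>W\<close> applied to the part of \<open>\<phi> x\<close> below \<open>c\<close>. The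
  second lies in the sum of the \<open>M b\<close>: on a stratum with a partial splitting, V \<phi>
  V = V says that V \<phi>, the projection onto \<open>M b\<close>, fixes every value of
  \<open>W\<close>. The first can be any element below \<open>c\<close>, but it is absent when
  \<open>W x = 0\<close>. The second correction passes through degree n - 1, where strata outside
  P_n may be nonzero although no splitting is assumed for them. Their images under \<open>W\<close>
  lie in \<open>F_n^b = 0\<close>, so they contribute nothing. Once these facts are established,
  powers of \<open>\<Phi>\<close> are a matter of a single abelian group with a triangular
  endomorphism and a strictly increasing function \<open>d\<close>.\<close>

lemma (in abelian_group) submodule_sum_least:
  assumes H: "additive_subgroup H G" and S: "\<And>i. i \<in> I \<Longrightarrow> S i \<subseteq> H"
  shows "submodule_sum G I S \<subseteq> H"
proof
  fix x assume "x \<in> submodule_sum G I S"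
  then obtain J f where J: "finite J" "J \<subseteq> I" "f \<in> Pi J S" "x = finsum G f J"
    unfolding submodule_sum_def by blast
  have "f \<in> J \<rightarrow> H" using J(2,3) S by (fastforce simp: Pi_def)
  with J(1) have "finsum G f J \<in> H"
  proof (induction J)
    case empty
    then show ?case by (simp add: additive_subgroup.zero_closed[OF H])
  next
    case (insert j J)
    then have "f \<in> insert j J \<rightarrow> carrier G"
      using additive_subgroup.a_subset[OF H] by (auto simp: Pi_def)
    then have "finsum G f (insert j J) = f j \<oplus> finsum G f J"
      using insert.hyps by (intro finsum_insert) auto
    with insert show ?case by (auto intro!: additive_subgroup.a_closed[OF H])
  qed
  then show "x \<in> H" using J by simp
qed

lemma (in abelian_group_hom) additive_subgroup_vimage:
  assumes "additive_subgroup K H"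
  shows "additive_subgroup {x \<in> carrier G. h x \<in> K} G"
proof (intro additive_subgroupI G.add.subgroupI)
  show "{x \<in> carrier G. h x \<in> K} \<noteq> {}"
    using additive_subgroup.zero_closed[OF assms] by (auto intro!: exI[of _ "\<zero>\<^bsub>G\<^esub>"])
next
  fix x assume "x \<in> {x \<in> carrier G. h x \<in> K}"
  then show "\<ominus>\<^bsub>G\<^esub> x \<in> {x \<in> carrier G. h x \<in> K}"
    using assms by (simp add: additive_subgroup.a_inv_closed)
qed (use assms in \<open>auto simp: additive_subgroup.a_closed\<close>)

lemma (in abelian_group_hom) additive_subgroup_image:
  assumes "additive_subgroup K G"
  shows "additive_subgroup (h ` K) H"
  using group_hom.subgroup_img_is_subgroup[OF a_group_hom additive_subgroup.a_subgroup[OF assms]]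
  by (rule additive_subgroupI)

lemma (in abelian_group_hom) hom_minus:
  assumes "x \<in> carrier G" "y \<in> carrier G"
  shows "h (x \<ominus>\<^bsub>G\<^esub> y) = h x \<ominus>\<^bsub>H\<^esub> h y"
  using assms by (simp add: a_minus_def)

text \<open>The preimage of \<open>K\<close> is a subgroup containing every \<open>S i\<close>,
  hence it contains their sum. This reduces each later inclusion for a sum to a check on single
  strata.\<close>

lemma (in abelian_group_hom) image_submodule_sum_subset:
  assumes K: "additive_subgroup K H"
    and S: "\<And>i. i \<in> I \<Longrightarrow> S i \<subseteq> carrier G" "\<And>i. i \<in> I \<Longrightarrow> h ` S i \<subseteq> K"
  shows "h ` submodule_sum G I S \<subseteq> K"
  using G.submodule_sum_least[OF additive_subgroup_vimage[OF K], of I S] S by blast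

lemma abelian_group_hom_funpow:
  assumes "abelian_group_hom G G h"
  shows "abelian_group_hom G G (h ^^ k)"
proof -
  interpret abelian_group_hom G G h by fact
  have "h ^^ k \<in> hom (add_monoid G) (add_monoid G)"
    by (induction k) (auto simp: hom_def Pi_def)
  then show ?thesis
    by (intro abelian_group_homI G.abelian_group_axioms)
       (simp add: group_hom_def group_hom_axioms_def G.a_group)
qed

lemma (in abelian_group) direct_mono:
  assumes S: "\<And>i. i \<in> I \<Longrightarrow> additive_subgroup (S i) G" and d: "direct G I S"
    and J: "J \<subseteq> I" "\<And>i. i \<in> J \<Longrightarrow> T i \<subseteq> S i"
  shows "direct G J T"
  unfolding direct_def
proof (intro allI impI)
  fix K f assume K: "finite K" "K \<subseteq> J" "f \<in> Pi K T" "finsum G f K = \<zero>"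
  have "K \<subseteq> I" "f \<in> Pi K S" using K J by (fastforce simp: Pi_def)+
  then show "\<forall>i\<in>K. f i = \<zero>" using d K unfolding direct_def by blast
qed

text \<open>In a vanishing sum, the leading terms at a maximal index cannot be cancelled.\<close>

lemma (in abelian_group) direct_triangular:
  fixes S T :: "'p::order \<Rightarrow> 'a set"
  assumes S: "\<And>c. c \<in> I \<Longrightarrow> additive_subgroup (S c) G" and d: "direct G I S"
    and T: "\<And>c t. \<lbrakk>c \<in> I; t \<in> T c\<rbrakk> \<Longrightarrow>
      \<exists>s\<in>S c. \<exists>l\<in>submodule_sum G {b\<in>I. b < c} S. t = s \<oplus> l \<and> (s = \<zero> \<longrightarrow> t = \<zero>)"
  shows "direct G I T"
  unfolding direct_def
proof (intro allI impI)
  fix J f assume J: "finite J" "J \<subseteq> I" "f \<in> Pi J T" "finsum G f J = \<zero>"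
  have sub: "additive_subgroup (submodule_sum G K S) G" if "K \<subseteq> I" for K
    using S that by (intro submodule_sum_subgroup) auto
  have T_sum: "T c \<subseteq> submodule_sum G {b\<in>I. b \<le> c} S" if c: "c \<in> I" for c
  proof
    fix t assume "t \<in> T c"
    then obtain s l where sl: "s \<in> S c" "l \<in> submodule_sum G {b\<in>I. b < c} S" "t = s \<oplus> l"
      using T c by blast
    have "s \<in> submodule_sum G {b\<in>I. b \<le> c} S"
      using sl c S additive_subgroup.a_subset by (intro submodule_sum_memI[of c]) auto
    moreover have "l \<in> submodule_sum G {b\<in>I. b \<le> c} S"
      using sl(2) by (rule subsetD[OF submodule_sum_mono, rotated]) auto
    ultimately show "t \<in> submodule_sum G {b\<in>I. b \<le> c} S"
      using sl by (auto intro: additive_subgroup.a_closed[OF sub])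
  qed
  have fc: "f \<in> J \<rightarrow> carrier G"
  proof
    fix j assume "j \<in> J"
    then have "f j \<in> submodule_sum G {b\<in>I. b \<le> j} S" using J T_sum by blast
    then show "f j \<in> carrier G" using additive_subgroup.a_subset[OF sub[of "{b\<in>I. b \<le> j}"]] by blast
  qed
  show "\<forall>i\<in>J. f i = \<zero>"
  proof (rule ccontr)
    assume "\<not> (\<forall>i\<in>J. f i = \<zero>)"
    then have ne: "{i\<in>J. f i \<noteq> \<zero>} \<noteq> {}" by blast
    obtain c where c: "c \<in> {i\<in>J. f i \<noteq> \<zero>}" and max: "\<And>b. b \<in> {i\<in>J. f i \<noteq> \<zero>} \<Longrightarrow> c \<le> b \<Longrightarrow> c = b"
      using finite_has_maximal[OF _ ne] J(1) by auto
    have cI: "c \<in> I" using c J by auto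
    obtain s l where sl: "s \<in> S c" "l \<in> submodule_sum G {b\<in>I. b < c} S" "f c = s \<oplus> l"
      "s = \<zero> \<longrightarrow> f c = \<zero>"
      using T[OF cI, of "f c"] c J by blast
    let ?R = "submodule_sum G (I - {c}) S"
    have R: "additive_subgroup ?R G" by (rule sub) auto
    have rest: "finsum G f (J - {c}) \<in> ?R"
    proof -
      \<comment> \<open>The singletons \<open>{f j}\<close> present the finite sum as an element of
        a \<open>submodule_sum\<close>, so that it can be bounded term by term. By maximality of
        \<open>c\<close>, a nonzero \<open>f j\<close> has \<open>c\<close> not below
        \<open>j\<close>, so the indices up to \<open>j\<close> avoid \<open>c\<close>.\<close>
      have "submodule_sum G (J - {c}) (\<lambda>j. {f j}) \<subseteq> ?R"
      proof (rule submodule_sum_least[OF R])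
        fix j assume j: "j \<in> J - {c}"
        show "{f j} \<subseteq> ?R"
        proof (cases "f j = \<zero>")
          case False
          then have "\<not> c \<le> j" using max[of j] j by auto
          then have "{b\<in>I. b \<le> j} \<subseteq> I - {c}" by auto
          then have "submodule_sum G {b\<in>I. b \<le> j} S \<subseteq> ?R" by (rule submodule_sum_mono)
          moreover have "f j \<in> submodule_sum G {b\<in>I. b \<le> j} S" using j J T_sum by blast
          ultimately show ?thesis by blast
        qed (simp add: additive_subgroup.zero_closed[OF R])
      qed
      moreover have "finsum G f (J - {c}) \<in> submodule_sum G (J - {c}) (\<lambda>j. {f j})"
        unfolding submodule_sum_def using J(1) by auto
      ultimately show ?thesis by blast
    qed
    have l: "l \<in> ?R"
      using sl(2) by (rule subsetD[OF submodule_sum_mono, rotated]) auto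
    have carr: "s \<in> carrier G" "l \<in> carrier G" "finsum G f (J - {c}) \<in> carrier G"
      using sl(1) l rest additive_subgroup.a_subset[OF S[OF cI]] additive_subgroup.a_subset[OF R] by auto
    have "\<zero> = finsum G f (insert c (J - {c}))" using J(4) c by (simp add: insert_absorb)
    also have "\<dots> = f c \<oplus> finsum G f (J - {c})" using J(1) fc c by (intro finsum_insert) auto
    finally have "s \<oplus> (l \<oplus> finsum G f (J - {c})) = \<zero>" using sl(3) carr by (simp add: a_assoc)
    then have "s = \<ominus> (l \<oplus> finsum G f (J - {c}))" using carr by (intro minus_equality[symmetric]) auto
    also have "\<dots> \<in> ?R" using l rest R by (simp add: additive_subgroup.a_closed additive_subgroup.a_inv_closed)
    finally have "s = \<zero>"
      using S d cI sl(1) by (intro direct_disjoint[of I S c "I - {c}"]) auto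
    then show False using sl(4) c by simp
  qed
qed

lemma (in abelian_group_hom) hom_finsum:
  assumes "finite J" "f \<in> J \<rightarrow> carrier G"
  shows "h (finsum G f J) = finsum H (\<lambda>i. h (f i)) J"
  using assms by (induction J) (auto simp: Pi_def)

lemma module_hom_abelian_group_hom:
  assumes "h \<in> module_hom R A B" "abelian_group A" "abelian_group B"
  shows "abelian_group_hom A B h"
proof (rule abelian_group_homI[OF assms(2,3)])
  show "group_hom (add_monoid A) (add_monoid B) h"
    using assms by (auto simp: group_hom_def group_hom_axioms_def hom_def module_hom_def abelian_group.a_group)
qed

text \<open>Treating a scalar as an additive endomorphism lets the group-level results on sums also
  deliver compatibility with scalars.\<close>

lemma (in left_module) smult_hom:
  assumes "r \<in> carrier R"
  shows "abelian_group_hom M M (\<lambda>x. r \<odot>\<^bsub>M\<^esub> x)"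
proof (rule abelian_group_homI[OF M.abelian_group_axioms M.abelian_group_axioms])
  show "group_hom (add_monoid M) (add_monoid M) (\<lambda>x. r \<odot>\<^bsub>M\<^esub> x)"
    using assms by (auto simp: group_hom_def group_hom_axioms_def hom_def smult_r_distr M.a_group)
qed

lemma module_hom_comp:
  assumes "f \<in> module_hom R A B" "g \<in> module_hom R B C"
  shows "(\<lambda>x. g (f x)) \<in> module_hom R A C"
  using assms by (auto simp: module_hom_def Pi_def)

lemma module_hom_funpow:
  assumes "h \<in> module_hom R A A"
  shows "h ^^ k \<in> module_hom R A A"
  by (induction k) (use assms in \<open>auto simp: module_hom_def Pi_def\<close>)


section \<open>Triangular endomorphisms\<close>

text \<open>The situation in one fixed degree, detached from the complex. The targets matter:
  \<open>\<Phi>_C\<close> and \<open>\<Phi>_M\<close> allow only lower terms in \<open>M\<close>,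
  which makes powers vanish on \<open>M\<close> and become constant on \<open>C\<close>, while
  \<open>\<Phi>_N\<close> allows arbitrary lower terms. Of the chain dimension, the inductions use
  that \<open>d\<close> increases strictly.\<close>

locale triangular_endomorphism = abelian_group_hom A A \<Phi> for A (structure) and \<Phi> +
  fixes I :: "'p::order set" and S N C M :: "'p \<Rightarrow> 'a set" and d :: "'p \<Rightarrow> nat"
  assumes S_subgroup: "c \<in> I \<Longrightarrow> additive_subgroup (S c) A"
    and S_direct: "direct A I S"
    and C_subgroup: "c \<in> I \<Longrightarrow> additive_subgroup (C c) A"
    and N_subset: "c \<in> I \<Longrightarrow> N c \<subseteq> S c"
    and C_subset: "c \<in> I \<Longrightarrow> C c \<subseteq> S c"
    and M_subset: "c \<in> I \<Longrightarrow> M c \<subseteq> S c"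
    and decomposition: "\<lbrakk>c \<in> I; x \<in> S c\<rbrakk> \<Longrightarrow> \<exists>u\<in>N c. \<exists>v\<in>C c. \<exists>w\<in>M c. x = u \<oplus> v \<oplus> w"
    and \<Phi>_N: "\<lbrakk>c \<in> I; x \<in> N c\<rbrakk> \<Longrightarrow> \<Phi> x \<in> submodule_sum A {b\<in>I. b < c} S"
    and \<Phi>_C: "\<lbrakk>c \<in> I; x \<in> C c\<rbrakk> \<Longrightarrow> \<Phi> x \<ominus> x \<in> submodule_sum A {b\<in>I. b < c} M"
    and \<Phi>_M: "\<lbrakk>c \<in> I; x \<in> M c\<rbrakk> \<Longrightarrow> \<Phi> x \<in> submodule_sum A {b\<in>I. b < c} M"
    and d_less: "\<lbrakk>b \<in> I; c \<in> I; b < c\<rbrakk> \<Longrightarrow> d b < d c"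
begin

text \<open>The eventual image of \<open>C b\<close>: by \<open>power_C\<close> all exponents from
  \<open>d b\<close> on agree on \<open>C b\<close>.\<close>

abbreviation stable :: "'p \<Rightarrow> 'a set"
  where "stable b \<equiv> (\<Phi> ^^ d b) ` C b"

lemma power_hom: "abelian_group_hom A A (\<Phi> ^^ k)"
  by (intro abelian_group_hom_funpow is_abelian_group_hom)

lemma S_carrier: "c \<in> I \<Longrightarrow> S c \<subseteq> carrier A"
  using S_subgroup additive_subgroup.a_subset by blast

lemma C_carrier: "c \<in> I \<Longrightarrow> C c \<subseteq> carrier A"
  using S_carrier C_subset by blast

lemma S_sum_subgroup: "J \<subseteq> I \<Longrightarrow> additive_subgroup (submodule_sum A J S) A"
  using S_subgroup by (intro G.submodule_sum_subgroup) auto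

lemma M_sum_subset:
  assumes "J \<subseteq> I"
  shows "submodule_sum A J M \<subseteq> submodule_sum A J S"
proof (rule G.submodule_sum_least[OF S_sum_subgroup[OF assms]])
  fix c assume c: "c \<in> J"
  then have "S c \<subseteq> submodule_sum A J S"
    using S_carrier[of c] assms by (blast intro: G.submodule_sum_memI)
  then show "M c \<subseteq> submodule_sum A J S" using M_subset[of c] c assms by blast
qed

lemma stable_sum_subgroup:
  assumes "J \<subseteq> I"
  shows "additive_subgroup (submodule_sum A J stable) A"
proof (rule G.submodule_sum_subgroup)
  fix b assume "b \<in> J"
  interpret P: abelian_group_hom A A "\<Phi> ^^ d b" by (rule power_hom)
  show "additive_subgroup (stable b) A"
    using \<open>b \<in> J\<close> assms C_subgroup by (intro P.additive_subgroup_image) auto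
qed

text \<open>One application leads to the \<open>M b\<close> with \<open>b < c\<close>, where
  \<open>d b < d c\<close> leaves room for an exponent smaller by one. The bound is strict because
  at least one application is needed: if \<open>d c = 0\<close>, no index of \<open>I\<close> lies
  below \<open>c\<close>, and \<open>\<Phi> x\<close> is an empty sum.\<close>

lemma power_M:
  assumes "c \<in> I" "x \<in> M c" "d c < k"
  shows "(\<Phi> ^^ k) x = \<zero>"
  using assms
proof (induction k arbitrary: c x)
  case (Suc k)
  interpret P: abelian_group_hom A A "\<Phi> ^^ k" by (rule power_hom)
  have "(\<Phi> ^^ k) ` submodule_sum A {b\<in>I. b < c} M \<subseteq> {\<zero>}"
  proof (rule P.image_submodule_sum_subset)
    show "additive_subgroup {\<zero>} A" by (intro additive_subgroupI G.add.triv_subgroup)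
    fix b assume b: "b \<in> {b\<in>I. b < c}"
    then show "M b \<subseteq> carrier A" using M_subset S_carrier by blast
    show "(\<Phi> ^^ k) ` M b \<subseteq> {\<zero>}"
      using b Suc.IH[of b] Suc.prems d_less[of b c] by fastforce
  qed
  then show ?case using \<Phi>_M[OF Suc.prems(1,2)] by (auto simp: funpow_swap1)
qed simp

text \<open>The two sides differ by \<open>\<Phi> ^^ k\<close> applied to
  \<open>\<Phi> x \<ominus> x\<close>, which lives in the \<open>M b\<close> with
  \<open>b < c\<close>. There \<open>d b < d c \<le> k\<close>, so \<open>power_M\<close> applies;
  hence the bound is one better than for \<open>M c\<close> itself.\<close>

lemma power_Suc_C:
  assumes "c \<in> I" "x \<in> C c" "d c \<le> k"
  shows "(\<Phi> ^^ Suc k) x = (\<Phi> ^^ k) x"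
proof -
  interpret P: abelian_group_hom A A "\<Phi> ^^ k" by (rule power_hom)
  have x: "x \<in> carrier A" using assms C_carrier by blast
  have "(\<Phi> ^^ k) ` submodule_sum A {b\<in>I. b < c} M \<subseteq> {\<zero>}"
  proof (rule P.image_submodule_sum_subset)
    show "additive_subgroup {\<zero>} A" by (intro additive_subgroupI G.add.triv_subgroup)
    fix b assume b: "b \<in> {b\<in>I. b < c}"
    then show "M b \<subseteq> carrier A" using M_subset S_carrier by blast
    show "(\<Phi> ^^ k) ` M b \<subseteq> {\<zero>}"
      using b assms power_M[of b _ k] d_less[of b c] by fastforce
  qed
  then have "(\<Phi> ^^ k) (\<Phi> x \<ominus> x) = \<zero>" using \<Phi>_C[OF assms(1,2)] by blast
  then have "(\<Phi> ^^ k) (\<Phi> x) \<ominus> (\<Phi> ^^ k) x = \<zero>" using x by (simp add: P.hom_minus)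
  then show ?thesis using x by (auto dest!: G.minus_eq_zeroD simp: funpow_swap1)
qed

lemma power_C:
  assumes "c \<in> I" "x \<in> C c" "d c \<le> k"
  shows "(\<Phi> ^^ k) x = (\<Phi> ^^ d c) x"
  using assms(3)
proof (induction rule: dec_induct)
  case (step k)
  then show ?case using power_Suc_C[OF assms(1,2), of k] by simp
qed simp

text \<open>The two claims need a joint induction: \<open>N c\<close> with exponent
  \<open>Suc k\<close> is reduced by one application to \<open>S b\<close> for \<open>b < c\<close>
  with exponent \<open>k\<close>, whereas \<open>S c\<close> uses the claim for \<open>N c\<close>
  with the same exponent, the constancy on \<open>C c\<close> and the vanishing on
  \<open>M c\<close>.\<close>

lemma power_N_S:
  assumes "c \<in> I" "d c < k"
  shows "(\<Phi> ^^ k) ` N c \<subseteq> submodule_sum A {b\<in>I. b < c} stable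
    \<and> (\<Phi> ^^ k) ` S c \<subseteq> submodule_sum A {b\<in>I. b \<le> c} stable"
  using assms
proof (induction k arbitrary: c)
  case (Suc k)
  interpret P: abelian_group_hom A A "\<Phi> ^^ k" by (rule power_hom)
  interpret P': abelian_group_hom A A "\<Phi> ^^ Suc k" by (rule power_hom)
  have "(\<Phi> ^^ k) ` submodule_sum A {b\<in>I. b < c} S \<subseteq> submodule_sum A {b\<in>I. b < c} stable"
  proof (rule P.image_submodule_sum_subset)
    show "additive_subgroup (submodule_sum A {b\<in>I. b < c} stable) A"
      by (rule stable_sum_subgroup) auto
    fix b assume b: "b \<in> {b\<in>I. b < c}"
    then show "S b \<subseteq> carrier A" using S_carrier by blast
    have "(\<Phi> ^^ k) ` S b \<subseteq> submodule_sum A {b'\<in>I. b' \<le> b} stable"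
      using b Suc.IH[of b] Suc.prems d_less[of b c] by auto
    also have "\<dots> \<subseteq> submodule_sum A {b\<in>I. b < c} stable"
      using b by (intro submodule_sum_mono) auto
    finally show "(\<Phi> ^^ k) ` S b \<subseteq> submodule_sum A {b\<in>I. b < c} stable" .
  qed
  then have N: "(\<Phi> ^^ Suc k) ` N c \<subseteq> submodule_sum A {b\<in>I. b < c} stable"
    using \<Phi>_N[OF Suc.prems(1)] by (auto simp: funpow_swap1)
  have "(\<Phi> ^^ Suc k) x \<in> submodule_sum A {b\<in>I. b \<le> c} stable" if xS: "x \<in> S c" for x
  proof -
    obtain u v w where x: "u \<in> N c" "v \<in> C c" "w \<in> M c" "x = u \<oplus> v \<oplus> w"
      using decomposition[OF Suc.prems(1) xS] by blast
    have carr: "u \<in> carrier A" "v \<in> carrier A" "w \<in> carrier A"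
      using x Suc.prems(1) N_subset C_subset M_subset S_carrier by blast+
    have stc: "stable c \<subseteq> carrier A"
      using C_carrier[OF Suc.prems(1)] abelian_group_hom.hom_closed[OF power_hom] by blast
    have u: "(\<Phi> ^^ Suc k) u \<in> submodule_sum A {b\<in>I. b \<le> c} stable"
      using subsetD[OF N imageI[OF x(1)]] by (rule subsetD[OF submodule_sum_mono, rotated]) auto
    have v: "(\<Phi> ^^ Suc k) v \<in> submodule_sum A {b\<in>I. b \<le> c} stable"
      using power_C[OF Suc.prems(1) x(2), of "Suc k"] Suc.prems x(2) stc
      by (intro G.submodule_sum_memI[of c]) auto
    have w: "(\<Phi> ^^ Suc k) w = \<zero>" using power_M[of c w "Suc k"] Suc.prems x(3) by blast
    have "(\<Phi> ^^ Suc k) x = (\<Phi> ^^ Suc k) u \<oplus> (\<Phi> ^^ Suc k) v"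
      using x(4) carr w P'.hom_add P'.hom_closed G.r_zero by (simp del: funpow.simps)
    then show ?thesis
      using u v additive_subgroup.a_closed[OF stable_sum_subgroup[of "{b\<in>I. b \<le> c}"]]
      by (simp del: funpow.simps)
  qed
  then show ?case using N by blast
qed simp

text \<open>The fixed points of \<open>\<Phi>\<close> form a subgroup, and
  \<open>power_Suc_C\<close> at exponent \<open>d b\<close> puts each \<open>stable b\<close> into
  it.\<close>

lemma stable_sum_fixed:
  assumes "J \<subseteq> I" "x \<in> submodule_sum A J stable"
  shows "\<Phi> x = x"
proof -
  have "additive_subgroup {x \<in> carrier A. \<Phi> x = x} A"
  proof (intro additive_subgroupI G.add.subgroupI)
    show "{x \<in> carrier A. \<Phi> x = x} \<noteq> {}" by (auto intro!: exI[of _ \<zero>])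
  qed auto
  moreover have "stable b \<subseteq> {x \<in> carrier A. \<Phi> x = x}" if "b \<in> J" for b
  proof -
    have "b \<in> I" using that assms by blast
    then show ?thesis using power_Suc_C[of b _ "d b"] C_carrier[of b]
      abelian_group_hom.hom_closed[OF power_hom[of "d b"]] by auto
  qed
  ultimately have "submodule_sum A J stable \<subseteq> {x \<in> carrier A. \<Phi> x = x}"
    by (rule G.submodule_sum_least)
  then show ?thesis using assms by blast
qed

text \<open>That \<open>J\<close> is closed downwards keeps the lower terms produced by
  \<open>power_N_S\<close> inside the sum. Conversely, \<open>stable c\<close> equals the image of
  \<open>C c\<close> under \<open>\<Phi> ^^ k\<close>, since \<open>k\<close> exceeds
  \<open>d c\<close>, and \<open>C c\<close> is part of \<open>S c\<close>.\<close>

lemma power_S_sum: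
  assumes "J \<subseteq> I" "\<And>b c. \<lbrakk>b \<in> I; c \<in> J; b \<le> c\<rbrakk> \<Longrightarrow> b \<in> J" "\<And>c. c \<in> J \<Longrightarrow> d c < k"
  shows "(\<Phi> ^^ k) ` submodule_sum A J S = submodule_sum A J stable"
proof
  interpret P: abelian_group_hom A A "\<Phi> ^^ k" by (rule power_hom)
  show "(\<Phi> ^^ k) ` submodule_sum A J S \<subseteq> submodule_sum A J stable"
  proof (rule P.image_submodule_sum_subset[OF stable_sum_subgroup[OF assms(1)]])
    fix c assume c: "c \<in> J"
    then show "S c \<subseteq> carrier A" using assms S_carrier by blast
    have "(\<Phi> ^^ k) ` S c \<subseteq> submodule_sum A {b\<in>I. b \<le> c} stable"
      using c assms power_N_S[of c k] by blast
    also have "\<dots> \<subseteq> submodule_sum A J stable"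
      using assms c by (intro submodule_sum_mono) auto
    finally show "(\<Phi> ^^ k) ` S c \<subseteq> submodule_sum A J stable" .
  qed
  have "additive_subgroup ((\<Phi> ^^ k) ` submodule_sum A J S) A"
    by (intro P.additive_subgroup_image S_sum_subgroup assms)
  moreover have "stable c \<subseteq> (\<Phi> ^^ k) ` submodule_sum A J S" if c: "c \<in> J" for c
  proof
    fix y assume "y \<in> stable c"
    then obtain x where x: "x \<in> C c" "y = (\<Phi> ^^ d c) x" by blast
    have cI: "c \<in> I" using c assms by blast
    have "x \<in> submodule_sum A J S"
      using x c cI C_subset S_carrier by (intro G.submodule_sum_memI[of c]) auto
    moreover have "y = (\<Phi> ^^ k) x"
      using power_C[OF cI x(1), of k] x(2) assms(3)[OF c] by simp
    ultimately show "y \<in> (\<Phi> ^^ k) ` submodule_sum A J S" by blast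
  qed
  ultimately show "submodule_sum A J stable \<subseteq> (\<Phi> ^^ k) ` submodule_sum A J S"
    by (rule G.submodule_sum_least)
qed

text \<open>Makes the sum of the strata strictly below an index invariant under
  \<open>\<Phi>\<close>, as the comparison of leading terms requires.\<close>

lemma \<Phi>_S:
  assumes "c \<in> I" "x \<in> S c"
  shows "\<Phi> x \<in> submodule_sum A {b\<in>I. b \<le> c} S"
proof -
  let ?L = "submodule_sum A {b\<in>I. b \<le> c} S"
  have L: "additive_subgroup ?L A" by (rule S_sum_subgroup) auto
  have less: "submodule_sum A {b\<in>I. b < c} S \<subseteq> ?L" by (rule submodule_sum_mono) auto
  obtain u v w where x: "u \<in> N c" "v \<in> C c" "w \<in> M c" "x = u \<oplus> v \<oplus> w"
    using decomposition[OF assms] by blast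
  have carr: "u \<in> carrier A" "v \<in> carrier A" "w \<in> carrier A"
    using x assms N_subset C_subset M_subset S_carrier by blast+
  have M: "submodule_sum A {b\<in>I. b < c} M \<subseteq> ?L"
    using M_sum_subset[of "{b\<in>I. b < c}"] less by auto
  have "v \<in> ?L" using x(2) assms C_subset S_carrier by (intro G.submodule_sum_memI[of c]) auto
  moreover have "\<Phi> v \<ominus> v \<in> ?L" using \<Phi>_C[OF assms(1) x(2)] M by blast
  ultimately have "v \<oplus> (\<Phi> v \<ominus> v) \<in> ?L" by (rule additive_subgroup.a_closed[OF L])
  also have "v \<oplus> (\<Phi> v \<ominus> v) = \<Phi> v"
    using carr by (simp add: a_minus_def G.a_lcomm[of v] G.r_neg)
  finally have v: "\<Phi> v \<in> ?L" .
  have "\<Phi> x = \<Phi> u \<oplus> \<Phi> v \<oplus> \<Phi> w" using x(4) carr by simp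
  moreover have "\<Phi> u \<in> ?L" using \<Phi>_N[OF assms(1) x(1)] less by blast
  moreover have "\<Phi> w \<in> ?L" using \<Phi>_M[OF assms(1) x(3)] M by blast
  ultimately show ?thesis using v by (simp add: additive_subgroup.a_closed[OF L])
qed

text \<open>If \<open>l\<close> collects the lower terms so far, the next step replaces it by
  \<open>(\<Phi> x \<ominus> x) \<oplus> \<Phi> l\<close>, which is again strictly lower, while
  \<open>x\<close> itself is carried along.\<close>

lemma power_C_leading_term:
  assumes c: "c \<in> I" and x: "x \<in> C c"
  shows "\<exists>l\<in>submodule_sum A {b\<in>I. b < c} S. (\<Phi> ^^ k) x = x \<oplus> l"
proof (induction k)
  case 0
  have "x \<in> carrier A" using assms C_carrier by blast
  then show ?case using G.submodule_sum_zero by (intro bexI[of _ \<zero>]) auto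
next
  case (Suc k)
  let ?L = "submodule_sum A {b\<in>I. b < c} S"
  have L: "additive_subgroup ?L A" by (rule S_sum_subgroup) auto
  obtain l where l: "l \<in> ?L" "(\<Phi> ^^ k) x = x \<oplus> l" using Suc by blast
  have xc: "x \<in> carrier A" "l \<in> carrier A"
    using assms C_carrier l additive_subgroup.a_subset[OF L] by blast+
  have "\<Phi> ` ?L \<subseteq> ?L"
  proof (rule image_submodule_sum_subset[OF L])
    fix b assume b: "b \<in> {b\<in>I. b < c}"
    then show "S b \<subseteq> carrier A" using S_carrier by blast
    have "submodule_sum A {b'\<in>I. b' \<le> b} S \<subseteq> ?L" using b by (intro submodule_sum_mono) auto
    then show "\<Phi> ` S b \<subseteq> ?L" using b \<Phi>_S by blast
  qed
  then have "(\<Phi> x \<ominus> x) \<oplus> \<Phi> l \<in> ?L"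
    using l \<Phi>_C[OF assms] M_sum_subset[of "{b\<in>I. b < c}"]
    by (intro additive_subgroup.a_closed[OF L]) auto
  moreover have "(\<Phi> ^^ Suc k) x = x \<oplus> ((\<Phi> x \<ominus> x) \<oplus> \<Phi> l)"
    using l(2) xc by (simp add: a_minus_def G.a_assoc G.a_lcomm[of x] G.r_neg2 G.r_neg1)
  ultimately show ?case by blast
qed

text \<open>The exponents may vary with \<open>c\<close>, because the leading term \<open>x\<close>
  of \<open>(\<Phi> ^^ k c) x\<close> is the same for all of them.\<close>

lemma power_C_direct: "direct A I (\<lambda>c. (\<Phi> ^^ k c) ` C c)"
proof (rule G.direct_triangular[OF S_subgroup S_direct])
  fix c t assume c: "c \<in> I" and "t \<in> (\<Phi> ^^ k c) ` C c"
  then obtain x where x: "x \<in> C c" "t = (\<Phi> ^^ k c) x" by blast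
  interpret P: abelian_group_hom A A "\<Phi> ^^ k c" by (rule power_hom)
  show "\<exists>s\<in>S c. \<exists>l\<in>submodule_sum A {b\<in>I. b < c} S. t = s \<oplus> l \<and> (s = \<zero> \<longrightarrow> t = \<zero>)"
    using power_C_leading_term[OF c x(1), of "k c"] x c C_subset P.hom_zero by blast
qed

text \<open>An element of \<open>C c\<close> killed by the power equals the negative of its own
  lower terms, so it lies both in \<open>S c\<close> and in the sum of the strata below and must
  vanish.\<close>

lemma power_C_inj:
  assumes c: "c \<in> I"
  shows "inj_on (\<Phi> ^^ k) (C c)"
proof
  fix x y assume xy: "x \<in> C c" "y \<in> C c" "(\<Phi> ^^ k) x = (\<Phi> ^^ k) y"
  interpret P: abelian_group_hom A A "\<Phi> ^^ k" by (rule power_hom)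
  let ?L = "submodule_sum A {b\<in>I. b < c} S"
  have L: "additive_subgroup ?L A" by (rule S_sum_subgroup) auto
  have carr: "x \<in> carrier A" "y \<in> carrier A" using xy c C_carrier by blast+
  have z: "x \<ominus> y \<in> C c" unfolding a_minus_def using xy C_subgroup[OF c]
    by (simp add: additive_subgroup.a_closed additive_subgroup.a_inv_closed)
  then obtain l where l: "l \<in> ?L" "(\<Phi> ^^ k) (x \<ominus> y) = (x \<ominus> y) \<oplus> l"
    using power_C_leading_term[OF c] by blast
  have lc: "l \<in> carrier A" using l additive_subgroup.a_subset[OF L] by blast
  have "(\<Phi> ^^ k) (x \<ominus> y) = \<zero>" using xy carr by (simp add: P.hom_minus a_minus_def G.r_neg)
  then have "x \<ominus> y = \<ominus> l" using l(2) carr lc by (intro G.minus_equality[symmetric]) auto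
  then have "x \<ominus> y \<in> ?L" using l additive_subgroup.a_inv_closed[OF L] by simp
  moreover have "x \<ominus> y \<in> S c" using z C_subset[OF c] by blast
  ultimately have "x \<ominus> y = \<zero>"
    using c by (intro G.direct_disjoint[OF S_subgroup S_direct c, of "{b\<in>I. b < c}"]) auto
  then show "x = y" using carr by (rule G.minus_eq_zeroD)
qed

end


section \<open>Vector fields on a graded complex\<close>

context graded_complex
begin

lemma \<phi>_hom: "abelian_group_hom (F n) (F (n - 1)) (\<phi> n)"
  by (rule module_hom_abelian_group_hom[OF boundary_hom F_abelian_group F_abelian_group])

lemma G_sum_subgroup: "additive_subgroup (submodule_sum (F n) I (G n)) (F n)"
  by (intro abelian_group.submodule_sum_subgroup F_abelian_group G_subgroup)

section \<open>Projections onto the summands of the grading\<close>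

lemma component_eqI:
  assumes "y \<in> G n c" "z \<in> submodule_sum (F n) {b. b \<noteq> c} (G n)" "x = y \<oplus>\<^bsub>F n\<^esub> z"
  shows "component F G c n x = y"
proof -
  interpret abelian_group "F n" by (rule F_abelian_group)
  have "x \<in> carrier (F n)"
    using assms G_carrier additive_subgroup.a_subset[OF G_sum_subgroup] by blast
  then show ?thesis unfolding component_def
    using component_unique[of x n c] assms by (intro the1_equality) auto
qed

lemma component_cases:
  assumes "x \<in> carrier (F n)"
  obtains z where "component F G c n x \<in> G n c" "z \<in> submodule_sum (F n) {b. b \<noteq> c} (G n)"
    "x = component F G c n x \<oplus>\<^bsub>F n\<^esub> z"
  using theI'[OF component_unique[OF assms, of c]] unfolding component_def[symmetric] by blast

lemma component_mem: "x \<in> carrier (F n) \<Longrightarrow> component F G c n x \<in> G n c"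
  by (erule component_cases)

lemma component_carrier: "x \<in> carrier (F n) \<Longrightarrow> component F G c n x \<in> carrier (F n)"
  using component_mem G_carrier by blast

lemma component_zeroI:
  assumes "x \<in> submodule_sum (F n) {b. b \<noteq> c} (G n)"
  shows "component F G c n x = \<zero>\<^bsub>F n\<^esub>"
proof -
  interpret abelian_group "F n" by (rule F_abelian_group)
  have "x \<in> carrier (F n)" using assms additive_subgroup.a_subset[OF G_sum_subgroup] by blast
  then show ?thesis
    by (intro component_eqI[OF additive_subgroup.zero_closed[OF G_subgroup] assms]) simp
qed

lemma component_hom: "component F G c n \<in> module_hom R (F n) (F n)"
proof -
  interpret left_module R "F n" by (rule left_module)
  let ?S = "submodule_sum (F n) {b. b \<noteq> c} (G n)"
  have Sc: "?S \<subseteq> carrier (F n)" by (rule additive_subgroup.a_subset[OF G_sum_subgroup])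
  show ?thesis unfolding module_hom_def
  proof (intro CollectI conjI ballI)
    show "component F G c n \<in> carrier (F n) \<rightarrow> carrier (F n)" using component_carrier by blast
  next
    fix x y assume x: "x \<in> carrier (F n)" and y: "y \<in> carrier (F n)"
    obtain z where z: "z \<in> ?S" "x = component F G c n x \<oplus>\<^bsub>F n\<^esub> z" using component_cases[OF x] .
    obtain w where w: "w \<in> ?S" "y = component F G c n y \<oplus>\<^bsub>F n\<^esub> w" using component_cases[OF y] .
    have zw: "z \<in> carrier (F n)" "w \<in> carrier (F n)" using z(1) w(1) Sc by blast+
    show "component F G c n (x \<oplus>\<^bsub>F n\<^esub> y) = component F G c n x \<oplus>\<^bsub>F n\<^esub> component F G c n y"
    proof (rule component_eqI)
      show "component F G c n x \<oplus>\<^bsub>F n\<^esub> component F G c n y \<in> G n c"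
        using x y by (intro additive_subgroup.a_closed[OF G_subgroup] component_mem)
      show "z \<oplus>\<^bsub>F n\<^esub> w \<in> ?S" using z(1) w(1) by (rule additive_subgroup.a_closed[OF G_sum_subgroup])
      have "x \<oplus>\<^bsub>F n\<^esub> y = (component F G c n x \<oplus>\<^bsub>F n\<^esub> z) \<oplus>\<^bsub>F n\<^esub> (component F G c n y \<oplus>\<^bsub>F n\<^esub> w)"
        using z(2) w(2) by simp
      then show "x \<oplus>\<^bsub>F n\<^esub> y =
          (component F G c n x \<oplus>\<^bsub>F n\<^esub> component F G c n y) \<oplus>\<^bsub>F n\<^esub> (z \<oplus>\<^bsub>F n\<^esub> w)"
        using component_carrier[OF x] component_carrier[OF y] zw by (simp add: M.a_ac)
    qed
  next
    fix r x assume r: "r \<in> carrier R" and x: "x \<in> carrier (F n)"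
    obtain z where z: "z \<in> ?S" "x = component F G c n x \<oplus>\<^bsub>F n\<^esub> z" using component_cases[OF x] .
    have zc: "z \<in> carrier (F n)" using z(1) Sc by blast
    have rG: "r \<odot>\<^bsub>F n\<^esub> y \<in> G n b" if "y \<in> G n b" for y b
      using grading that r by (auto simp: grading_def intro: submodule.smult_closed)
    show "component F G c n (r \<odot>\<^bsub>F n\<^esub> x) = r \<odot>\<^bsub>F n\<^esub> component F G c n x"
    proof (rule component_eqI)
      show "r \<odot>\<^bsub>F n\<^esub> component F G c n x \<in> G n c" by (rule rG[OF component_mem[OF x]])
      \<comment> \<open>The complement \<open>?S\<close> has so far only been treated as an additive
        subgroup; stability under scalars is inherited from the submodules
        \<open>G n b\<close>.\<close>
      have "(\<lambda>x. r \<odot>\<^bsub>F n\<^esub> x) ` ?S \<subseteq> ?S"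
      proof (rule abelian_group_hom.image_submodule_sum_subset[OF smult_hom[OF r] G_sum_subgroup G_carrier])
        fix b assume "b \<in> {b. b \<noteq> c}"
        then have "G n b \<subseteq> ?S" using G_carrier by (auto intro!: M.submodule_sum_memI)
        then show "(\<lambda>x. r \<odot>\<^bsub>F n\<^esub> x) ` G n b \<subseteq> ?S" using rG by blast
      qed
      then show "r \<odot>\<^bsub>F n\<^esub> z \<in> ?S" using z(1) by blast
      have "r \<odot>\<^bsub>F n\<^esub> x = r \<odot>\<^bsub>F n\<^esub> (component F G c n x \<oplus>\<^bsub>F n\<^esub> z)" using z(2) by simp
      then show "r \<odot>\<^bsub>F n\<^esub> x = r \<odot>\<^bsub>F n\<^esub> component F G c n x \<oplus>\<^bsub>F n\<^esub> r \<odot>\<^bsub>F n\<^esub> z"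
        using component_carrier[OF x] zc r by (simp add: smult_r_distr)
    qed
  qed
qed

text \<open>\<open>finsum\<close> over an infinite set is zero by convention, so this finiteness is
  what gives \<open>induced_field\<close> its intended meaning. The support lies in the index set of
  any finite representation of \<open>x\<close>.\<close>

lemma finite_component_support:
  assumes "x \<in> carrier (F n)"
  shows "finite {c. component F G c n x \<noteq> \<zero>\<^bsub>F n\<^esub>}"
proof -
  obtain J f where J: "finite J" "f \<in> Pi J (G n)" "x = finsum (F n) f J"
    using assms carrier_eq[of n] unfolding submodule_sum_def by blast
  have "component F G c n x = \<zero>\<^bsub>F n\<^esub>" if "c \<notin> J" for c
  proof (rule component_zeroI)
    show "x \<in> submodule_sum (F n) {b. b \<noteq> c} (G n)"
      unfolding submodule_sum_def using J that by (intro CollectI exI[of _ J] exI[of _ f]) auto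
  qed
  then have "{c. component F G c n x \<noteq> \<zero>\<^bsub>F n\<^esub>} \<subseteq> J" by blast
  then show ?thesis using J(1) by (rule finite_subset)
qed

section \<open>The boundary split into its diagonal and strictly lower parts\<close>

lemma lower_subset_strictly_lower:
  assumes "b < c"
  shows "lower F G b n \<subseteq> strictly_lower F G c n"
  unfolding strictly_lower_eq lower_def using assms by (intro submodule_sum_mono) auto

text \<open>Each F(b) is a subcomplex, and for \<open>b < c\<close> it is contained in the complex
  that is divided out at \<open>c\<close>.\<close>

lemma boundary_strictly_lower:
  assumes "x \<in> strictly_lower F G c n"
  shows "\<phi> n x \<in> strictly_lower F G c (n - 1)"
proof -
  have "\<phi> n ` strictly_lower F G c n \<subseteq> strictly_lower F G c (n - 1)"
    unfolding strictly_lower_eq[of c n]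
  proof (rule abelian_group_hom.image_submodule_sum_subset[OF \<phi>_hom strictly_lower_subgroup G_carrier])
    fix b assume "b \<in> {b. b < c}"
    then have "lower F G b (n - 1) \<subseteq> strictly_lower F G c (n - 1)"
      by (intro lower_subset_strictly_lower) simp
    moreover have "\<phi> n ` G n b \<subseteq> lower F G b (n - 1)"
      using grading G_lower unfolding grading_def by blast
    ultimately show "\<phi> n ` G n b \<subseteq> strictly_lower F G c (n - 1)" by blast
  qed
  then show ?thesis using assms by blast
qed

lemma component_strictly_lower:
  "x \<in> strictly_lower F G c n \<Longrightarrow> component F G c n x = \<zero>\<^bsub>F n\<^esub>"
  unfolding strictly_lower_eq
  by (intro component_zeroI, erule subsetD[OF submodule_sum_mono, rotated]) auto

text \<open>Unlike \<^const>\<open>stratum_boundary\<close>, this is a homomorphism on all of \<open>F\<^sub>n\<close>.\<close>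

definition diagonal :: "'p \<Rightarrow> int \<Rightarrow> 'm \<Rightarrow> 'm"
  where "diagonal c n x = component F G c (n - 1) (\<phi> n x)"

lemma diagonal_hom: "abelian_group_hom (F n) (F (n - 1)) (diagonal c n)"
  unfolding diagonal_def[abs_def]
  by (rule module_hom_abelian_group_hom[OF module_hom_comp[OF boundary_hom component_hom]
        F_abelian_group F_abelian_group])

lemma diagonal_mem:
  assumes "x \<in> carrier (F n)"
  shows "diagonal c n x \<in> G (n - 1) c"
  unfolding diagonal_def
  by (intro component_mem abelian_group_hom.hom_closed[OF \<phi>_hom] assms)

lemma stratum_boundary_cases:
  assumes "x \<in> G n c"
  obtains l where "l \<in> strictly_lower F G c (n - 1)"
    "\<phi> n x = stratum_boundary F \<phi> G c n x \<oplus>\<^bsub>F (n - 1)\<^esub> l"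
proof
  interpret A: abelian_group "F (n - 1)" by (rule F_abelian_group)
  let ?y = "stratum_boundary F \<phi> G c n x"
  have y: "?y \<in> carrier (F (n - 1))" using stratum_boundary_coset[OF assms] G_carrier by blast
  have x: "\<phi> n x \<in> carrier (F (n - 1))"
    using assms G_carrier by (intro abelian_group_hom.hom_closed[OF \<phi>_hom]) blast
  show "\<phi> n x \<ominus>\<^bsub>F (n - 1)\<^esub> ?y \<in> strictly_lower F G c (n - 1)"
    using stratum_boundary_coset[OF assms] lower_coset_eq_iff[OF x y, of c] by simp
  show "\<phi> n x = ?y \<oplus>\<^bsub>F (n - 1)\<^esub> (\<phi> n x \<ominus>\<^bsub>F (n - 1)\<^esub> ?y)"
    using x y by (simp add: a_minus_def A.a_lcomm[of ?y] A.r_neg)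
qed

text \<open>The two boundaries differ by a strictly lower term, which has no component at
  \<open>c\<close>.\<close>

lemma stratum_boundary_eq_diagonal:
  assumes "x \<in> G n c"
  shows "stratum_boundary F \<phi> G c n x = diagonal c n x"
proof -
  obtain l where l: "l \<in> strictly_lower F G c (n - 1)"
    "\<phi> n x = stratum_boundary F \<phi> G c n x \<oplus>\<^bsub>F (n - 1)\<^esub> l"
    using stratum_boundary_cases[OF assms] .
  have "l \<in> submodule_sum (F (n - 1)) {b. b \<noteq> c} (G (n - 1))"
    using l(1) unfolding strictly_lower_eq by (rule subsetD[OF submodule_sum_mono, rotated]) auto
  then show ?thesis unfolding diagonal_def
    using stratum_boundary_coset[OF assms] l(2) by (intro component_eqI[symmetric]) auto
qed

lemma diagonal_cases:
  assumes "x \<in> G n c"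
  obtains l where "l \<in> strictly_lower F G c (n - 1)" "\<phi> n x = diagonal c n x \<oplus>\<^bsub>F (n - 1)\<^esub> l"
  using stratum_boundary_cases[OF assms] unfolding stratum_boundary_eq_diagonal[OF assms] .

text \<open>Apply the second \<open>diagonal\<close> to
  \<open>\<phi> n x = diagonal c n x \<oplus> l\<close>: the left side gives zero because \<phi>
  squares to zero, and \<open>l\<close> gives zero because its boundary is still strictly
  lower.\<close>

lemma diagonal_diagonal:
  assumes x: "x \<in> G n c"
  shows "diagonal c (n - 1) (diagonal c n x) = \<zero>\<^bsub>F (n - 2)\<^esub>"
proof -
  interpret D: abelian_group_hom "F (n - 1)" "F (n - 2)" "diagonal c (n - 1)"
    using diagonal_hom[of "n - 1" c] by simp
  interpret A: abelian_group "F (n - 1)" by (rule F_abelian_group)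
  obtain l where l: "l \<in> strictly_lower F G c (n - 1)" "\<phi> n x = diagonal c n x \<oplus>\<^bsub>F (n - 1)\<^esub> l"
    using diagonal_cases[OF x] .
  have carr: "x \<in> carrier (F n)" "l \<in> carrier (F (n - 1))" "diagonal c n x \<in> carrier (F (n - 1))"
    using x G_carrier l(1) additive_subgroup.a_subset[OF strictly_lower_subgroup] diagonal_mem by blast+
  have "diagonal c (n - 1) l = \<zero>\<^bsub>F (n - 2)\<^esub>"
    using component_strictly_lower[OF boundary_strictly_lower[OF l(1)]] by (simp add: diagonal_def)
  moreover have "diagonal c (n - 1) (\<phi> n x) = \<zero>\<^bsub>F (n - 2)\<^esub>"
    using boundary_boundary[OF carr(1)] component_zeroI[OF abelian_group.submodule_sum_zero[OF F_abelian_group], of c "n - 2"]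
    by (simp add: diagonal_def)
  ultimately show ?thesis using l(2) carr by simp
qed

end

section \<open>The induced vector field and its flow on homogeneous elements\<close>

locale graded_vector_field = graded_complex R F \<phi> G
  for R :: "('r, 's) ring_scheme" and F :: "int \<Rightarrow> ('r, 'm) module" and \<phi>
    and G :: "int \<Rightarrow> 'p::order \<Rightarrow> 'm set" +
  fixes V :: "'p \<Rightarrow> int \<Rightarrow> 'm \<Rightarrow> 'm"
  assumes vector_fields: "vector_field R (stratum F G c) (V c)"
begin

abbreviation W :: "int \<Rightarrow> 'm \<Rightarrow> 'm"
  where "W \<equiv> induced_field F G V"

lemma V_mem: "x \<in> G n c \<Longrightarrow> V c n x \<in> G (n + 1) c"
  and V_add: "\<lbrakk>x \<in> G n c; y \<in> G n c\<rbrakk> \<Longrightarrow> V c n (x \<oplus>\<^bsub>F n\<^esub> y) = V c n x \<oplus>\<^bsub>F (n + 1)\<^esub> V c n y"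
  and V_smult: "\<lbrakk>r \<in> carrier R; x \<in> G n c\<rbrakk> \<Longrightarrow> V c n (r \<odot>\<^bsub>F n\<^esub> x) = r \<odot>\<^bsub>F (n + 1)\<^esub> V c n x"
  and V_V: "x \<in> G n c \<Longrightarrow> V c (n + 1) (V c n x) = \<zero>\<^bsub>F (n + 2)\<^esub>"
  using vector_fields[of c]
  by (auto simp: vector_field_def chain_homotopy_def module_hom_def stratum_def)

lemma V_carrier: "x \<in> G n c \<Longrightarrow> V c n x \<in> carrier (F (n + 1))"
  using V_mem G_carrier by blast

lemma V_zero: "V c n \<zero>\<^bsub>F n\<^esub> = \<zero>\<^bsub>F (n + 1)\<^esub>"
proof -
  interpret A: abelian_group "F n" by (rule F_abelian_group)
  interpret B: abelian_group "F (n + 1)" by (rule F_abelian_group)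
  have z: "\<zero>\<^bsub>F n\<^esub> \<in> G n c" by (rule additive_subgroup.zero_closed[OF G_subgroup])
  have "V c n \<zero>\<^bsub>F n\<^esub> \<oplus>\<^bsub>F (n + 1)\<^esub> V c n \<zero>\<^bsub>F n\<^esub> = V c n \<zero>\<^bsub>F n\<^esub>"
    using V_add[OF z z] by simp
  then show ?thesis using V_carrier[OF z] by simp
qed

text \<open>Allows the sums defining \<open>W\<close> at \<open>x\<close>, \<open>y\<close>, their
  sum or a multiple to be compared over one common finite index set, although the supports
  differ.\<close>

lemma W_eq_finsum:
  assumes "x \<in> carrier (F n)" "finite J" "{c. component F G c n x \<noteq> \<zero>\<^bsub>F n\<^esub>} \<subseteq> J"
  shows "W n x = (\<Oplus>\<^bsub>F (n + 1)\<^esub>c\<in>J. V c n (component F G c n x))"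
proof -
  interpret abelian_group "F (n + 1)" by (rule F_abelian_group)
  show ?thesis unfolding induced_field_def
    using assms V_zero V_carrier[OF component_mem[OF assms(1)]]
    by (intro add.finprod_mono_neutral_cong_left) auto
qed

lemma W_module_hom: "W n \<in> module_hom R (F n) (F (n + 1))"
proof -
  interpret A: left_module R "F n" by (rule left_module)
  interpret B: left_module R "F (n + 1)" by (rule left_module)
  let ?s = "\<lambda>x. {c. component F G c n x \<noteq> \<zero>\<^bsub>F n\<^esub>}"
  let ?v = "\<lambda>x c. V c n (component F G c n x)"
  have v: "?v x \<in> J \<rightarrow> carrier (F (n + 1))" if "x \<in> carrier (F n)" for x J
    using V_carrier[OF component_mem[OF that]] by blast
  show ?thesis unfolding module_hom_def
  proof (intro CollectI conjI ballI)
    show "W n \<in> carrier (F n) \<rightarrow> carrier (F (n + 1))"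
      unfolding induced_field_def using v by (auto intro!: B.M.finsum_closed)
  next
    fix x y assume x: "x \<in> carrier (F n)" and y: "y \<in> carrier (F n)"
    have xy: "x \<oplus>\<^bsub>F n\<^esub> y \<in> carrier (F n)" using x y by simp
    let ?J = "?s x \<union> ?s y \<union> ?s (x \<oplus>\<^bsub>F n\<^esub> y)"
    have J: "finite ?J" using x y xy finite_component_support by simp
    have "W n (x \<oplus>\<^bsub>F n\<^esub> y) = finsum (F (n + 1)) (?v (x \<oplus>\<^bsub>F n\<^esub> y)) ?J"
      by (rule W_eq_finsum[OF xy J]) blast
    also have "?v (x \<oplus>\<^bsub>F n\<^esub> y) = (\<lambda>c. ?v x c \<oplus>\<^bsub>F (n + 1)\<^esub> ?v y c)"
      using component_hom x y component_mem V_add by (auto simp: module_hom_def)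
    also have "finsum (F (n + 1)) \<dots> ?J = finsum (F (n + 1)) (?v x) ?J \<oplus>\<^bsub>F (n + 1)\<^esub> finsum (F (n + 1)) (?v y) ?J"
      by (rule B.M.finsum_addf[OF v[OF x] v[OF y]])
    also have "finsum (F (n + 1)) (?v x) ?J = W n x" by (rule W_eq_finsum[OF x J, symmetric]) blast
    also have "finsum (F (n + 1)) (?v y) ?J = W n y" by (rule W_eq_finsum[OF y J, symmetric]) blast
    finally show "W n (x \<oplus>\<^bsub>F n\<^esub> y) = W n x \<oplus>\<^bsub>F (n + 1)\<^esub> W n y" .
  next
    fix r x assume r: "r \<in> carrier R" and x: "x \<in> carrier (F n)"
    have rx: "r \<odot>\<^bsub>F n\<^esub> x \<in> carrier (F n)" using r x by simp
    let ?J = "?s x \<union> ?s (r \<odot>\<^bsub>F n\<^esub> x)"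
    have J: "finite ?J" using x rx finite_component_support by simp
    have "W n (r \<odot>\<^bsub>F n\<^esub> x) = finsum (F (n + 1)) (?v (r \<odot>\<^bsub>F n\<^esub> x)) ?J"
      by (rule W_eq_finsum[OF rx J]) blast
    also have "?v (r \<odot>\<^bsub>F n\<^esub> x) = (\<lambda>c. r \<odot>\<^bsub>F (n + 1)\<^esub> ?v x c)"
      using component_hom r x component_mem V_smult by (auto simp: module_hom_def)
    also have "finsum (F (n + 1)) \<dots> ?J = r \<odot>\<^bsub>F (n + 1)\<^esub> finsum (F (n + 1)) (?v x) ?J"
      by (rule abelian_group_hom.hom_finsum[OF B.smult_hom[OF r] J v[OF x], symmetric])
    also have "finsum (F (n + 1)) (?v x) ?J = W n x" by (rule W_eq_finsum[OF x J, symmetric]) blast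
    finally show "W n (r \<odot>\<^bsub>F n\<^esub> x) = r \<odot>\<^bsub>F (n + 1)\<^esub> W n x" .
  qed
qed

lemma W_hom: "abelian_group_hom (F n) (F (n + 1)) (W n)"
  by (rule module_hom_abelian_group_hom[OF W_module_hom F_abelian_group F_abelian_group])

lemma W_G: "x \<in> G n c \<Longrightarrow> W n x = V c n x"
  by (rule induced_field_homogeneous[OF vector_fields])

lemma W_mem: "x \<in> G n c \<Longrightarrow> W n x \<in> G (n + 1) c"
  using W_G V_mem by simp

lemma W_W: "x \<in> G n c \<Longrightarrow> W (n + 1) (W n x) = \<zero>\<^bsub>F (n + 2)\<^esub>"
  using W_G[of x n c] W_G[OF V_mem, of x n c] V_V by simp

abbreviation \<Psi> :: "int \<Rightarrow> 'm \<Rightarrow> 'm"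
  where "\<Psi> \<equiv> flow F \<phi> W"

lemma flow_module_hom: "\<Psi> n \<in> module_hom R (F n) (F n)"
proof -
  interpret left_module R "F n" by (rule left_module)
  have f: "(\<lambda>x. \<phi> (n + 1) (W n x)) \<in> module_hom R (F n) (F n)"
    using module_hom_comp[OF W_module_hom[of n] boundary_hom[of "n + 1"]] by simp
  have g: "(\<lambda>x. W (n - 1) (\<phi> n x)) \<in> module_hom R (F n) (F n)"
    using module_hom_comp[OF boundary_hom[of n] W_module_hom[of "n - 1"]] by simp
  have neg: "r \<odot>\<^bsub>F n\<^esub> (\<ominus>\<^bsub>F n\<^esub> x) = \<ominus>\<^bsub>F n\<^esub> (r \<odot>\<^bsub>F n\<^esub> x)"
    if "r \<in> carrier R" "x \<in> carrier (F n)" for r x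
    using abelian_group_hom.hom_a_inv[OF smult_hom[OF that(1)] that(2)] .
  show ?thesis using f g
    by (auto simp: module_hom_def flow_def Pi_def a_minus_def smult_r_distr neg M.minus_add M.a_ac)
qed

lemma flow_hom: "abelian_group_hom (F n) (F n) (\<Psi> n)"
  by (rule module_hom_abelian_group_hom[OF flow_module_hom F_abelian_group F_abelian_group])

text \<open>The bracket is the flow of the stratum at \<open>c\<close>; \<open>k\<close> and
  \<open>l\<close> are the strictly lower parts of \<open>\<phi> (n + 1) (W n x)\<close> and
  \<open>\<phi> n x\<close>. The clause on \<open>W n x\<close> is kept because \<open>k\<close> is
  otherwise unrestricted below \<open>c\<close>, whereas \<open>W (n - 1) l\<close> will turn out to
  lie in the \<open>M\<close> summands.\<close>

lemma flow_homogeneous: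
  assumes x: "x \<in> G n c"
  obtains k l where "k \<in> strictly_lower F G c n" "W n x = \<zero>\<^bsub>F (n + 1)\<^esub> \<Longrightarrow> k = \<zero>\<^bsub>F n\<^esub>"
    "l \<in> strictly_lower F G c (n - 1)"
    "\<Psi> n x = (x \<ominus>\<^bsub>F n\<^esub> diagonal c (n + 1) (W n x) \<ominus>\<^bsub>F n\<^esub> W (n - 1) (diagonal c n x))
      \<ominus>\<^bsub>F n\<^esub> (k \<oplus>\<^bsub>F n\<^esub> W (n - 1) l)"
proof -
  interpret A: abelian_group "F n" by (rule F_abelian_group)
  interpret W: abelian_group_hom "F (n - 1)" "F n" "W (n - 1)" using W_hom[of "n - 1"] by simp
  interpret f: abelian_group_hom "F (n + 1)" "F n" "\<phi> (n + 1)" using \<phi>_hom[of "n + 1"] by simp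
  interpret D: abelian_group_hom "F (n + 1)" "F n" "diagonal c (n + 1)" using diagonal_hom[of "n + 1"] by simp
  obtain l where l: "l \<in> strictly_lower F G c (n - 1)" "\<phi> n x = diagonal c n x \<oplus>\<^bsub>F (n - 1)\<^esub> l"
    using diagonal_cases[OF x] .
  obtain k where k: "k \<in> strictly_lower F G c n"
    "\<phi> (n + 1) (W n x) = diagonal c (n + 1) (W n x) \<oplus>\<^bsub>F n\<^esub> k"
    using diagonal_cases[OF W_mem[OF x]] by auto
  have carr: "x \<in> carrier (F n)" "l \<in> carrier (F (n - 1))" "k \<in> carrier (F n)"
    "diagonal c n x \<in> carrier (F (n - 1))" "W n x \<in> carrier (F (n + 1))"
    using x W_mem[OF x] G_carrier l(1) k(1) additive_subgroup.a_subset[OF strictly_lower_subgroup]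
      diagonal_mem by blast+
  show ?thesis
  proof (rule that[OF k(1) _ l(1)])
    assume "W n x = \<zero>\<^bsub>F (n + 1)\<^esub>"
    then show "k = \<zero>\<^bsub>F n\<^esub>" using k(2) carr by simp
  next
    show "\<Psi> n x = (x \<ominus>\<^bsub>F n\<^esub> diagonal c (n + 1) (W n x) \<ominus>\<^bsub>F n\<^esub> W (n - 1) (diagonal c n x))
      \<ominus>\<^bsub>F n\<^esub> (k \<oplus>\<^bsub>F n\<^esub> W (n - 1) l)"
      unfolding flow_def k(2) l(2) using carr by (simp add: a_minus_def A.minus_add A.a_ac)
  qed
qed

lemma splitting:
  assumes "partial_splitting R (stratum F G c) (stratum_boundary F \<phi> G c) (V c)" "x \<in> G n c"
  shows "W n (diagonal c (n + 1) (W n x)) = W n x"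
proof -
  have m: "W n x \<in> G (n + 1) c" using assms(2) by (rule W_mem)
  have "diagonal c (n + 1) (W n x) \<in> G n c"
    using diagonal_mem[of "W n x" "n + 1" c] m G_carrier by auto
  then have "W n (diagonal c (n + 1) (W n x)) = V c n (stratum_boundary F \<phi> G c (n + 1) (V c n x))"
    using W_G stratum_boundary_eq_diagonal[OF m] assms(2) by simp
  then show ?thesis using assms W_G by (simp add: partial_splitting_def stratum_def)
qed

lemma stratum_parts:
  "part_N (stratum F G c) (stratum_boundary F \<phi> G c) (V c) n
    = (\<lambda>x. diagonal c (n + 1) (W n x)) ` G n c"
  "part_C (stratum F G c) (stratum_boundary F \<phi> G c) (V c) n
    = {x \<in> G n c. W (n - 1) (diagonal c n x) = \<zero>\<^bsub>F n\<^esub> \<and> diagonal c (n + 1) (W n x) = \<zero>\<^bsub>F n\<^esub>}"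
  "part_M (stratum F G c) (stratum_boundary F \<phi> G c) (V c) n
    = (\<lambda>x. W (n - 1) (diagonal c n x)) ` G n c"
proof -
  have 1: "stratum_boundary F \<phi> G c (n + 1) (V c n x) = diagonal c (n + 1) (W n x)" if "x \<in> G n c" for x
    using stratum_boundary_eq_diagonal[OF V_mem[OF that]] W_G[OF that] by simp
  have 2: "V c (n - 1) (stratum_boundary F \<phi> G c n x) = W (n - 1) (diagonal c n x)" if "x \<in> G n c" for x
  proof -
    have "diagonal c n x \<in> G (n - 1) c" using that G_carrier by (intro diagonal_mem) blast
    then show ?thesis using stratum_boundary_eq_diagonal[OF that] W_G by simp
  qed
  show "part_N (stratum F G c) (stratum_boundary F \<phi> G c) (V c) n
    = (\<lambda>x. diagonal c (n + 1) (W n x)) ` G n c"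
    unfolding part_N_def using 1 by (auto simp: stratum_def intro!: image_cong)
  show "part_C (stratum F G c) (stratum_boundary F \<phi> G c) (V c) n
    = {x \<in> G n c. W (n - 1) (diagonal c n x) = \<zero>\<^bsub>F n\<^esub> \<and> diagonal c (n + 1) (W n x) = \<zero>\<^bsub>F n\<^esub>}"
    unfolding part_C_def using 1 2 by (auto simp: stratum_def)
  show "part_M (stratum F G c) (stratum_boundary F \<phi> G c) (V c) n
    = (\<lambda>x. W (n - 1) (diagonal c n x)) ` G n c"
    unfolding part_M_def using 2 by (auto simp: stratum_def intro!: image_cong)
qed

end

section \<open>Chain dimension and restriction to the support of the grading\<close>

text \<open>A chain ending in \<open>b\<close> extends by \<open>c\<close>, so its length is at most
  the dimension of \<open>c\<close> minus one. Finiteness at \<open>c\<close> turns this into a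
  strict inequality.\<close>

lemma poset_dim_less:
  assumes "b \<in> P" "c \<in> P" "b < c" "poset_dim P c \<noteq> \<infinity>"
  shows "poset_dim P b < poset_dim P c"
proof -
  obtain m where m: "poset_dim P c = enat m" using assms by auto
  have bound: "Suc k \<le> m" if f: "\<forall>i\<le>k. f i \<in> P" "\<forall>i<k. f i < f (Suc i)" "f k = b" for k f
  proof -
    let ?g = "f(Suc k := c)"
    have "(\<forall>i\<le>Suc k. ?g i \<in> P) \<and> (\<forall>i<Suc k. ?g i < ?g (Suc i)) \<and> ?g (Suc k) = c"
      using f assms by (auto simp: less_Suc_eq le_Suc_eq)
    then have "enat (Suc k) \<le> poset_dim P c" unfolding poset_dim_def by (intro Sup_upper) blast
    then show ?thesis using m by simp
  qed
  \<comment> \<open>The one-element chain at \<open>b\<close> shows that \<open>m\<close> is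
    positive, so the truncated \<open>m - 1\<close> below is really smaller than
    \<open>m\<close>.\<close>
  have "Suc 0 \<le> m" using assms(1) by (intro bound[of 0 "\<lambda>_. b"]) auto
  moreover have "poset_dim P b \<le> enat (m - 1)"
    unfolding poset_dim_def
  proof (rule Sup_least)
    fix x assume "x \<in> {enat k | k. \<exists>f. (\<forall>i\<le>k. f i \<in> P) \<and> (\<forall>i<k. f i < f (Suc i)) \<and> f k = b}"
    then obtain k f where k: "x = enat k" "\<forall>i\<le>k. f i \<in> P" "\<forall>i<k. f i < f (Suc i)" "f k = b" by blast
    then have "Suc k \<le> m" by (intro bound)
    then show "x \<le> enat (m - 1)" using k(1) by simp
  qed
  ultimately show ?thesis unfolding m by (auto intro: le_less_trans)
qed

text \<open>Summands outside the support are zero. This reconciles \<open>lower\<close> and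
  \<open>strictly_lower\<close>, which range over the whole poset, with the index set P_n.\<close>

lemma (in graded_complex) submodule_sum_support:
  "submodule_sum (F n) J (G n) = submodule_sum (F n) (J \<inter> grading_support F G n) (G n)"
proof (rule equalityI)
  interpret abelian_group "F n" by (rule F_abelian_group)
  show "submodule_sum (F n) J (G n) \<subseteq> submodule_sum (F n) (J \<inter> grading_support F G n) (G n)"
  proof (rule submodule_sum_least[OF G_sum_subgroup])
    fix b assume b: "b \<in> J"
    show "G n b \<subseteq> submodule_sum (F n) (J \<inter> grading_support F G n) (G n)"
    proof (cases "b \<in> grading_support F G n")
      case True
      then show ?thesis using b G_carrier by (auto intro!: submodule_sum_memI)
    next
      case False
      then show ?thesis by (simp add: grading_support_def submodule_sum_zero)
    qed
  qed
qed (rule submodule_sum_mono, blast)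

section \<open>The flow is triangular\<close>

context graded_vector_field
begin

text \<open>For \<open>c \<le> a\<close> in the support, the maps \<open>DW\<close> and
  \<open>WD\<close> of the proof are orthogonal idempotents on \<open>G n c\<close> with images
  \<open>N c\<close> and \<open>M c\<close> and common kernel \<open>C c\<close>. Idempotence uses
  the splitting in degree n for \<open>DW\<close> and in degree n - 1 for \<open>WD\<close>. One
  composite vanishes because \<open>diagonal\<close> squares to zero, the other because
  \<open>W\<close> does.\<close>

lemma triangular_endomorphism_flow:
  assumes a: "poset_dim (grading_support F G n) a \<noteq> \<infinity>" "a \<in> grading_support F G n"
    and split: "\<And>c. c \<in> grading_support F G n \<Longrightarrow> c \<le> a \<Longrightarrow>
      partial_splitting R (stratum F G c) (stratum_boundary F \<phi> G c) (V c)"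
  shows "triangular_endomorphism (F n) (\<Psi> n) {c \<in> grading_support F G n. c \<le> a} (G n)
    (\<lambda>c. part_N (stratum F G c) (stratum_boundary F \<phi> G c) (V c) n)
    (\<lambda>c. part_C (stratum F G c) (stratum_boundary F \<phi> G c) (V c) n)
    (\<lambda>c. part_M (stratum F G c) (stratum_boundary F \<phi> G c) (V c) n)
    (\<lambda>c. the_enat (poset_dim (grading_support F G n) c))"
proof -
  let ?P = "grading_support F G n"
  let ?I = "{c \<in> ?P. c \<le> a}"
  define DW where "DW = (\<lambda>c x. diagonal c (n + 1) (W n x))"
  define WD where "WD = (\<lambda>c x. W (n - 1) (diagonal c n x))"
  define N where "N = (\<lambda>c. DW c ` G n c)"
  define M where "M = (\<lambda>c. WD c ` G n c)"
  define C where "C = (\<lambda>c. {x \<in> G n c. WD c x = \<zero>\<^bsub>F n\<^esub> \<and> DW c x = \<zero>\<^bsub>F n\<^esub>})"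
  interpret A: abelian_group "F n" by (rule F_abelian_group)
  interpret W: abelian_group_hom "F n" "F (n + 1)" "W n" by (rule W_hom)
  interpret W': abelian_group_hom "F (n - 1)" "F n" "W (n - 1)" using W_hom[of "n - 1"] by simp
  interpret D: abelian_group_hom "F n" "F (n - 1)" "diagonal c n" for c by (rule diagonal_hom)
  interpret D': abelian_group_hom "F (n + 1)" "F n" "diagonal c (n + 1)" for c
    using diagonal_hom[of "n + 1"] by simp
  have neg0: "\<ominus>\<^bsub>F n\<^esub> \<zero>\<^bsub>F n\<^esub> = \<zero>\<^bsub>F n\<^esub>" by (rule A.minus_equality) simp_all
  have G0: "\<zero>\<^bsub>F n\<^esub> \<in> G n c" for c by (rule additive_subgroup.zero_closed[OF G_subgroup])
  have Gc: "x \<in> carrier (F n)" if "x \<in> G n c" for x c using that G_carrier by blast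
  have DW_mem: "DW c x \<in> G n c" if "x \<in> G n c" for c x
    unfolding DW_def using diagonal_mem[of "W n x" "n + 1" c] that Gc by simp
  have WD_mem: "WD c x \<in> G n c" if "x \<in> G n c" for c x
    unfolding WD_def using W_mem[OF diagonal_mem[of x n c]] that Gc by simp
  have DW_hom: "abelian_group_hom (F n) (F n) (DW c)" for c
    using W.a_group_hom D'.a_group_hom[of c]
    by (intro abelian_group_homI A.abelian_group_axioms)
       (auto simp: group_hom_def group_hom_axioms_def hom_def DW_def Pi_def)
  have WD_hom: "abelian_group_hom (F n) (F n) (WD c)" for c
    using W'.a_group_hom D.a_group_hom[of c]
    by (intro abelian_group_homI A.abelian_group_axioms)
       (auto simp: group_hom_def group_hom_axioms_def hom_def WD_def Pi_def)
  have W_DW: "W n (DW c x) = W n x" if "c \<in> ?I" "x \<in> G n c" for c x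
    unfolding DW_def using splitting split that by simp
  have DW_DW: "DW c (DW c x) = DW c x" if "c \<in> ?I" "x \<in> G n c" for c x
    using W_DW[OF that] by (simp add: DW_def)
  have D_DW: "diagonal c n (DW c x) = \<zero>\<^bsub>F (n - 1)\<^esub>" if "x \<in> G n c" for c x
    using diagonal_diagonal[OF W_mem[OF that]] by (simp add: DW_def)
  have WD_DW: "WD c (DW c x) = \<zero>\<^bsub>F n\<^esub>" if "x \<in> G n c" for c x
    using D_DW[OF that] by (simp add: WD_def)
  have W_WD: "W n (WD c x) = \<zero>\<^bsub>F (n + 1)\<^esub>" if "x \<in> G n c" for c x
    using W_W[OF diagonal_mem[of x n c]] Gc[OF that] by (simp add: WD_def add.commute)
  have DW_WD: "DW c (WD c x) = \<zero>\<^bsub>F n\<^esub>" if "x \<in> G n c" for c x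
    using W_WD[OF that] by (simp add: DW_def)
  have W_diag_W: "W (n - 1) (diagonal c n (W (n - 1) y)) = W (n - 1) y"
    if "c \<in> ?I" "y \<in> G (n - 1) c" for c y
    using splitting[of c y "n - 1"] split that by simp
  have WD_WD: "WD c (WD c x) = WD c x" if "c \<in> ?I" "x \<in> G n c" for c x
    using W_diag_W[OF that(1) diagonal_mem[of x n c]] Gc[OF that(2)] by (simp add: WD_def)
  have M_subgroup: "additive_subgroup (M c) (F n)" for c
    unfolding M_def by (rule abelian_group_hom.additive_subgroup_image[OF WD_hom G_subgroup])
  have M_sum: "additive_subgroup (submodule_sum (F n) J M) (F n)" for J
    by (rule A.submodule_sum_subgroup[OF M_subgroup])
  have lower_eq: "strictly_lower F G c n = submodule_sum (F n) {b \<in> ?I. b < c} (G n)" if "c \<in> ?I" for c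
  proof -
    have "{b. b < c} \<inter> ?P = {b \<in> ?I. b < c}" using that by auto
    then show ?thesis unfolding strictly_lower_eq
      using submodule_sum_support[of n "{b. b < c}"] by simp
  qed
  have M_sum_lower: "submodule_sum (F n) {b \<in> ?I. b < c} M \<subseteq> strictly_lower F G c n" if "c \<in> ?I" for c
  proof (rule A.submodule_sum_least[OF strictly_lower_subgroup])
    fix b assume b: "b \<in> {b \<in> ?I. b < c}"
    then have "G n b \<subseteq> strictly_lower F G c n"
      unfolding lower_eq[OF that] using G_carrier by (auto intro!: A.submodule_sum_memI)
    then show "M b \<subseteq> strictly_lower F G c n" unfolding M_def using WD_mem by blast
  qed
  \<comment> \<open>For \<open>y\<close> in \<open>G (n - 1) b\<close> with \<open>b\<close> in the
    support, the splitting gives \<open>W (n - 1) y = WD b (W (n - 1) y)\<close>, so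
    \<open>W (n - 1) y\<close> is its own witness for membership in \<open>M b\<close>.\<close>
  have W_lower: "W (n - 1) l \<in> submodule_sum (F n) {b \<in> ?I. b < c} M"
    if c: "c \<in> ?I" and l: "l \<in> strictly_lower F G c (n - 1)" for c l
  proof -
    let ?M = "submodule_sum (F n) {b \<in> ?I. b < c} M"
    have "W (n - 1) ` submodule_sum (F (n - 1)) {b. b < c} (G (n - 1)) \<subseteq> ?M"
    proof (rule W'.image_submodule_sum_subset[OF M_sum G_carrier])
      fix b assume b: "b \<in> {b. b < c}"
      have m: "W (n - 1) y \<in> G n b" if "y \<in> G (n - 1) b" for y using W_mem[OF that] by simp
      show "W (n - 1) ` G (n - 1) b \<subseteq> ?M"
      proof (cases "b \<in> ?P")
        case True
        then have bI: "b \<in> {b \<in> ?I. b < c}" using b c by auto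
        then have "W (n - 1) ` G (n - 1) b \<subseteq> M b"
          unfolding M_def WD_def using m W_diag_W[of b] by (auto intro!: image_eqI[of _ _ "W (n - 1) _"])
        also have "M b \<subseteq> ?M"
          using bI additive_subgroup.a_subset[OF M_subgroup] by (auto intro!: A.submodule_sum_memI)
        finally show ?thesis .
      next
        \<comment> \<open>No splitting is assumed at this \<open>b\<close>, but \<open>W\<close>
          preserves the index and \<open>G n b\<close> is zero.\<close>
        case False
        then have "W (n - 1) ` G (n - 1) b \<subseteq> {\<zero>\<^bsub>F n\<^esub>}" using m by (auto simp: grading_support_def)
        then show ?thesis by (rule subset_trans) (simp add: A.submodule_sum_zero)
      qed
    qed
    then show ?thesis using l unfolding strictly_lower_eq by blast
  qed
  have flow: "\<exists>k l. k \<in> strictly_lower F G c n \<and> (W n x = \<zero>\<^bsub>F (n + 1)\<^esub> \<longrightarrow> k = \<zero>\<^bsub>F n\<^esub>) \<and>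
      l \<in> submodule_sum (F n) {b \<in> ?I. b < c} M \<and> k \<in> carrier (F n) \<and> l \<in> carrier (F n) \<and>
      \<Psi> n x = (x \<ominus>\<^bsub>F n\<^esub> DW c x \<ominus>\<^bsub>F n\<^esub> WD c x) \<ominus>\<^bsub>F n\<^esub> (k \<oplus>\<^bsub>F n\<^esub> l)"
    if c: "c \<in> ?I" and x: "x \<in> G n c" for c x
  proof (rule flow_homogeneous[OF x])
    fix k l
    assume k: "k \<in> strictly_lower F G c n" "W n x = \<zero>\<^bsub>F (n + 1)\<^esub> \<Longrightarrow> k = \<zero>\<^bsub>F n\<^esub>"
      and l: "l \<in> strictly_lower F G c (n - 1)"
      and eq: "\<Psi> n x = (x \<ominus>\<^bsub>F n\<^esub> diagonal c (n + 1) (W n x) \<ominus>\<^bsub>F n\<^esub> W (n - 1) (diagonal c n x))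
        \<ominus>\<^bsub>F n\<^esub> (k \<oplus>\<^bsub>F n\<^esub> W (n - 1) l)"
    have Wl: "W (n - 1) l \<in> submodule_sum (F n) {b \<in> ?I. b < c} M" by (rule W_lower[OF c l])
    have "k \<in> carrier (F n)" "W (n - 1) l \<in> carrier (F n)"
      using k(1) Wl additive_subgroup.a_subset[OF strictly_lower_subgroup]
        additive_subgroup.a_subset[OF M_sum] by blast+
    then show ?thesis
      using k Wl eq unfolding DW_def WD_def by (intro exI[of _ k] exI[of _ "W (n - 1) l"]) simp
  qed
  \<comment> \<open>The form used for \<open>C c\<close> and \<open>M c\<close>: both are
    annihilated by \<open>W n\<close>, so the unrestricted term \<open>k\<close> drops out.\<close>
  have flow0: "\<exists>l. l \<in> submodule_sum (F n) {b \<in> ?I. b < c} M \<and> l \<in> carrier (F n) \<and>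
      \<Psi> n x = (x \<ominus>\<^bsub>F n\<^esub> DW c x \<ominus>\<^bsub>F n\<^esub> WD c x) \<ominus>\<^bsub>F n\<^esub> l"
    if c: "c \<in> ?I" and x: "x \<in> G n c" and W0: "W n x = \<zero>\<^bsub>F (n + 1)\<^esub>" for c x
  proof -
    obtain k l where kl: "W n x = \<zero>\<^bsub>F (n + 1)\<^esub> \<longrightarrow> k = \<zero>\<^bsub>F n\<^esub>"
      "l \<in> submodule_sum (F n) {b \<in> ?I. b < c} M" "l \<in> carrier (F n)"
      "\<Psi> n x = (x \<ominus>\<^bsub>F n\<^esub> DW c x \<ominus>\<^bsub>F n\<^esub> WD c x) \<ominus>\<^bsub>F n\<^esub> (k \<oplus>\<^bsub>F n\<^esub> l)"
      using flow[OF c x] by blast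
    then show ?thesis using W0 by (intro exI[of _ l]) simp
  qed
  have "triangular_endomorphism (F n) (\<Psi> n) ?I (G n) N C M (\<lambda>c. the_enat (poset_dim ?P c))"
  proof (intro triangular_endomorphism.intro flow_hom triangular_endomorphism_axioms.intro)
    show "additive_subgroup (G n c) (F n)" for c by (rule G_subgroup)
    show "direct (F n) ?I (G n)" using A.direct_mono[OF G_subgroup G_direct] by blast
    show "additive_subgroup (C c) (F n)" for c
    proof (intro additive_subgroupI A.add.subgroupI)
      interpret DW: abelian_group_hom "F n" "F n" "DW c" by (rule DW_hom)
      interpret WD: abelian_group_hom "F n" "F n" "WD c" by (rule WD_hom)
      show "C c \<subseteq> carrier (F n)" using Gc by (auto simp: C_def)
      have "\<zero>\<^bsub>F n\<^esub> \<in> C c" using G0 by (simp add: C_def)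
      then show "C c \<noteq> {}" by blast
      have C: "x \<in> G n c \<and> x \<in> carrier (F n) \<and> WD c x = \<zero>\<^bsub>F n\<^esub> \<and> DW c x = \<zero>\<^bsub>F n\<^esub>" if "x \<in> C c" for x
        using that Gc[of x c] by (simp add: C_def)
      show "\<ominus>\<^bsub>F n\<^esub> x \<in> C c" if "x \<in> C c" for x
        using C[OF that] by (simp add: C_def additive_subgroup.a_inv_closed[OF G_subgroup])
      show "x \<oplus>\<^bsub>F n\<^esub> y \<in> C c" if "x \<in> C c" "y \<in> C c" for x y
        using C[OF that(1)] C[OF that(2)] by (simp add: C_def additive_subgroup.a_closed[OF G_subgroup])
    qed
    show "N c \<subseteq> G n c" for c using DW_mem by (auto simp: N_def)
    show "C c \<subseteq> G n c" for c by (auto simp: C_def)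
    show "M c \<subseteq> G n c" for c using WD_mem by (auto simp: M_def)
    show "\<exists>u\<in>N c. \<exists>v\<in>C c. \<exists>w\<in>M c. x = u \<oplus>\<^bsub>F n\<^esub> v \<oplus>\<^bsub>F n\<^esub> w" if c: "c \<in> ?I" and x: "x \<in> G n c" for c x
    proof -
      interpret DW: abelian_group_hom "F n" "F n" "DW c" by (rule DW_hom)
      interpret WD: abelian_group_hom "F n" "F n" "WD c" by (rule WD_hom)
      \<comment> \<open>The complementary projection of the two orthogonal idempotents, which is
        also the flow of the stratum.\<close>
      let ?v = "x \<ominus>\<^bsub>F n\<^esub> DW c x \<ominus>\<^bsub>F n\<^esub> WD c x"
      have carr: "x \<in> carrier (F n)" "DW c x \<in> carrier (F n)" "WD c x \<in> carrier (F n)"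
        using Gc x DW_mem[OF x] WD_mem[OF x] by blast+
      have "?v \<in> G n c"
        unfolding a_minus_def using x DW_mem[OF x] WD_mem[OF x]
        by (intro additive_subgroup.a_closed[OF G_subgroup] additive_subgroup.a_inv_closed[OF G_subgroup])
      moreover have "WD c ?v = \<zero>\<^bsub>F n\<^esub>"
        using carr WD_DW[OF x] WD_WD[OF c x] by (simp add: a_minus_def A.r_neg neg0)
      moreover have "DW c ?v = \<zero>\<^bsub>F n\<^esub>"
        using carr DW_WD[OF x] DW_DW[OF c x] by (simp add: a_minus_def A.r_neg neg0)
      ultimately have "?v \<in> C c" by (simp add: C_def)
      moreover have "x = DW c x \<oplus>\<^bsub>F n\<^esub> ?v \<oplus>\<^bsub>F n\<^esub> WD c x"
      proof -
        have "DW c x \<oplus>\<^bsub>F n\<^esub> ?v \<oplus>\<^bsub>F n\<^esub> WD c x = DW c x \<oplus>\<^bsub>F n\<^esub> (x \<ominus>\<^bsub>F n\<^esub> DW c x)"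
          using carr by (simp add: a_minus_def A.a_assoc A.l_neg)
        also have "\<dots> = x" using carr by (simp add: a_minus_def A.a_lcomm[of "DW c x"] A.r_neg)
        finally show ?thesis by simp
      qed
      ultimately show ?thesis using x unfolding N_def M_def by blast
    qed
    show "\<Psi> n x \<in> submodule_sum (F n) {b \<in> ?I. b < c} (G n)" if c: "c \<in> ?I" and x: "x \<in> N c" for c x
    proof -
      obtain y where y: "y \<in> G n c" "x = DW c y" using x unfolding N_def by blast
      then have xG: "x \<in> G n c" using DW_mem by blast
      have xc: "x \<in> carrier (F n)" by (rule Gc[OF xG])
      obtain k l where kl: "k \<in> strictly_lower F G c n" "l \<in> submodule_sum (F n) {b \<in> ?I. b < c} M"
        "k \<in> carrier (F n)" "l \<in> carrier (F n)"
        "\<Psi> n x = (x \<ominus>\<^bsub>F n\<^esub> DW c x \<ominus>\<^bsub>F n\<^esub> WD c x) \<ominus>\<^bsub>F n\<^esub> (k \<oplus>\<^bsub>F n\<^esub> l)"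
        using flow[OF c xG] by blast
      \<comment> \<open>\<open>DW c x\<close> cancels \<open>x\<close>, leaving only lower terms.
        Here \<open>W n x\<close> may be nonzero, so \<open>k\<close> survives and only the strata
        themselves bound the result.\<close>
      have "DW c x = x" "WD c x = \<zero>\<^bsub>F n\<^esub>" using y DW_DW[OF c] WD_DW by simp_all
      then have "\<Psi> n x = \<ominus>\<^bsub>F n\<^esub> (k \<oplus>\<^bsub>F n\<^esub> l)"
        using kl xc by (simp add: a_minus_def A.r_neg neg0)
      moreover have "l \<in> strictly_lower F G c n" using kl(2) M_sum_lower[OF c] by blast
      ultimately have "\<Psi> n x \<in> strictly_lower F G c n"
        using kl(1) by (simp add: additive_subgroup.a_closed[OF strictly_lower_subgroup]
            additive_subgroup.a_inv_closed[OF strictly_lower_subgroup])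
      then show ?thesis unfolding lower_eq[OF c] .
    qed
    show "\<Psi> n x \<ominus>\<^bsub>F n\<^esub> x \<in> submodule_sum (F n) {b \<in> ?I. b < c} M" if c: "c \<in> ?I" and x: "x \<in> C c" for c x
    proof -
      have xG: "x \<in> G n c" and 0: "WD c x = \<zero>\<^bsub>F n\<^esub>" "DW c x = \<zero>\<^bsub>F n\<^esub>" using x by (auto simp: C_def)
      have xc: "x \<in> carrier (F n)" by (rule Gc[OF xG])
      have "W n x = \<zero>\<^bsub>F (n + 1)\<^esub>" using W_DW[OF c xG] 0(2) by simp
      from flow0[OF c xG this] obtain l
        where l: "l \<in> submodule_sum (F n) {b \<in> ?I. b < c} M" "l \<in> carrier (F n)"
          "\<Psi> n x = (x \<ominus>\<^bsub>F n\<^esub> DW c x \<ominus>\<^bsub>F n\<^esub> WD c x) \<ominus>\<^bsub>F n\<^esub> l"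
        by blast
      from l(3) have "\<Psi> n x = x \<oplus>\<^bsub>F n\<^esub> \<ominus>\<^bsub>F n\<^esub> l" using xc 0 by (simp add: a_minus_def neg0)
      then have "\<Psi> n x \<ominus>\<^bsub>F n\<^esub> x = \<ominus>\<^bsub>F n\<^esub> l" using xc l(2) by (simp add: A.add_minus_cancel)
      then show ?thesis using l(1) by (simp add: additive_subgroup.a_inv_closed[OF M_sum])
    qed
    show "\<Psi> n x \<in> submodule_sum (F n) {b \<in> ?I. b < c} M" if c: "c \<in> ?I" and x: "x \<in> M c" for c x
    proof -
      obtain y where y: "y \<in> G n c" "x = WD c y" using x unfolding M_def by blast
      then have xG: "x \<in> G n c" using WD_mem by blast
      have xc: "x \<in> carrier (F n)" by (rule Gc[OF xG])
      have "W n x = \<zero>\<^bsub>F (n + 1)\<^esub>" using W_WD y by simp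
      from flow0[OF c xG this] obtain l
        where l: "l \<in> submodule_sum (F n) {b \<in> ?I. b < c} M" "l \<in> carrier (F n)"
          "\<Psi> n x = (x \<ominus>\<^bsub>F n\<^esub> DW c x \<ominus>\<^bsub>F n\<^esub> WD c x) \<ominus>\<^bsub>F n\<^esub> l"
        by blast
      have "DW c x = \<zero>\<^bsub>F n\<^esub>" "WD c x = x" using y DW_WD WD_WD[OF c] by simp_all
      then have "\<Psi> n x = \<ominus>\<^bsub>F n\<^esub> l"
        using l(2,3) xc by (simp add: a_minus_def A.r_neg neg0)
      then show ?thesis using l(1) by (simp add: additive_subgroup.a_inv_closed[OF M_sum])
    qed
    show "the_enat (poset_dim ?P b) < the_enat (poset_dim ?P c)"
      if b: "b \<in> ?I" and c: "c \<in> ?I" and bc: "b < c" for b c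
    proof -
      \<comment> \<open>\<open>the_enat\<close> is meaningful on finite values only, so finiteness
        has to be passed down from \<open>a\<close> to \<open>c\<close> first.\<close>
      have "poset_dim ?P c \<noteq> \<infinity>"
      proof (cases "c = a")
        case False
        then have "poset_dim ?P c < poset_dim ?P a" using a c by (intro poset_dim_less) auto
        then show ?thesis by (cases "poset_dim ?P c") auto
      qed (use a in simp)
      moreover from this have "poset_dim ?P b < poset_dim ?P c"
        using b c bc by (intro poset_dim_less) auto
      ultimately show ?thesis by (cases "poset_dim ?P b"; cases "poset_dim ?P c") auto
    qed
  qed
  then show ?thesis unfolding stratum_parts N_def M_def C_def DW_def WD_def .
qed

end

section \<open>The claims on the flow, read off from its triangular form\<close>

theorem theorem3p2:
  fixes R :: "('r, 's) ring_scheme"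
    and F :: "int \<Rightarrow> ('r, 'm) module"
    and \<phi> :: "int \<Rightarrow> 'm \<Rightarrow> 'm"
    and G :: "int \<Rightarrow> 'p::order \<Rightarrow> 'm set"
    and V :: "'p \<Rightarrow> int \<Rightarrow> 'm \<Rightarrow> 'm"
    and n :: int
    and a :: 'p
    and P\<^sub>n :: "'p set"
    and d :: "'p \<Rightarrow> nat"
    and N C M :: "'p \<Rightarrow> 'm set"
    and \<Phi> :: "'m \<Rightarrow> 'm"
  assumes complex: "chain_complex R F \<phi>"
    and grading: "grading R F \<phi> G"
    and vector_fields: "\<And>c. vector_field R (stratum F G c) (V c)"
    and P_n: "P\<^sub>n = grading_support F G n"
    and a: "a \<in> P\<^sub>n"
    and finite_dim: "poset_dim P\<^sub>n a \<noteq> \<infinity>"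
    and d: "d = (\<lambda>c. the_enat (poset_dim P\<^sub>n c))"
    and splittings: "\<And>c. c \<in> P\<^sub>n \<Longrightarrow> c \<le> a \<Longrightarrow>
      partial_splitting R (stratum F G c) (stratum_boundary F \<phi> G c) (V c)"
    and N: "N = (\<lambda>c. part_N (stratum F G c) (stratum_boundary F \<phi> G c) (V c) n)"
    and C: "C = (\<lambda>c. part_C (stratum F G c) (stratum_boundary F \<phi> G c) (V c) n)"
    and M: "M = (\<lambda>c. part_M (stratum F G c) (stratum_boundary F \<phi> G c) (V c) n)"
    and flow: "\<Phi> = flow F \<phi> (induced_field F G V) n"
  shows
    "(\<forall>k :: 'p \<Rightarrow> nat.
        direct (F n) {c\<in>P\<^sub>n. c \<le> a} (\<lambda>c. (\<Phi> ^^ k c) ` C c)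
        \<and> (\<forall>c\<in>P\<^sub>n. c \<le> a \<longrightarrow>
              \<Phi> ^^ k c \<in> module_iso R ((F n)\<lparr>carrier := C c\<rparr>) ((F n)\<lparr>carrier := (\<Phi> ^^ k c) ` C c\<rparr>)))
    \<and> (\<forall>k. k > d a \<longrightarrow>
        (\<Phi> ^^ k) ` M a = {\<zero>\<^bsub>F n\<^esub>}
        \<and> (direct (F n) {b\<in>P\<^sub>n. b < a} M
            \<and> (\<lambda>x. \<Phi> x \<ominus>\<^bsub>F n\<^esub> x) ` C a \<subseteq> submodule_sum (F n) {b\<in>P\<^sub>n. b < a} M)
        \<and> (\<lambda>x. (\<Phi> ^^ k) x \<ominus>\<^bsub>F n\<^esub> (\<Phi> ^^ (k - 1)) x) ` C a = {\<zero>\<^bsub>F n\<^esub>}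
        \<and> (direct (F n) {b\<in>P\<^sub>n. b < a} (\<lambda>b. (\<Phi> ^^ d b) ` C b)
            \<and> (\<Phi> ^^ k) ` N a \<subseteq> submodule_sum (F n) {b\<in>P\<^sub>n. b < a} (\<lambda>b. (\<Phi> ^^ d b) ` C b))
        \<and> (\<lambda>x. (\<Phi> ^^ (k + 1)) x \<ominus>\<^bsub>F n\<^esub> (\<Phi> ^^ k) x) ` G n a = {\<zero>\<^bsub>F n\<^esub>}
        \<and> (direct (F n) {b\<in>P\<^sub>n. b \<le> a} (\<lambda>b. (\<Phi> ^^ d b) ` C b)
            \<and> (\<Phi> ^^ k) ` G n a \<subseteq> submodule_sum (F n) {b\<in>P\<^sub>n. b \<le> a} (\<lambda>b. (\<Phi> ^^ d b) ` C b))
        \<and> (\<lambda>x. (\<Phi> ^^ (k + 1)) x \<ominus>\<^bsub>F n\<^esub> (\<Phi> ^^ k) x) ` lower F G a n = {\<zero>\<^bsub>F n\<^esub>}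
        \<and> is_direct_sum (F n) ((\<Phi> ^^ k) ` lower F G a n) {b\<in>P\<^sub>n. b \<le> a} (\<lambda>b. (\<Phi> ^^ d b) ` C b))"
proof -
  let ?I = "{c\<in>P\<^sub>n. c \<le> a}"
  interpret gc: graded_complex R F \<phi> G
    using complex grading by (simp add: graded_complex_def graded_complex_axioms_def)
  interpret gv: graded_vector_field R F \<phi> G V
    using vector_fields by unfold_locales
  interpret T: triangular_endomorphism "F n" \<Phi> ?I "G n" N C M d
    using gv.triangular_endomorphism_flow[of n a] finite_dim a splittings
    unfolding N C M d flow P_n by blast
  have \<Phi>: "\<Phi> ^^ k \<in> module_hom R (F n) (F n)" for k
    unfolding flow by (rule module_hom_funpow[OF gv.flow_module_hom])
  have carr: "(\<Phi> ^^ k) x \<in> carrier (F n)" if "x \<in> carrier (F n)" for k x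
    using \<Phi>[of k] that by (auto simp: module_hom_def)
  have aI: "a \<in> ?I" using a by simp
  have less: "{b \<in> ?I. b < a} = {b\<in>P\<^sub>n. b < a}" by auto
  have lower: "lower F G a n = submodule_sum (F n) ?I (G n)"
  proof -
    have "{x. x \<le> a} \<inter> P\<^sub>n = ?I" by auto
    then show ?thesis
      unfolding lower_def using gc.submodule_sum_support[of n "{x. x \<le> a}"] P_n by simp
  qed
  \<comment> \<open>Makes the single bound \<open>d a < k\<close> sufficient at every index up to
    \<open>a\<close>, as \<open>T.power_S_sum\<close> demands.\<close>
  have d_le: "d c \<le> d a" if "c \<in> ?I" for c
    using that T.d_less[of c a] aI by (cases "c = a") (auto simp: order.strict_iff_order)
  have N0: "\<zero>\<^bsub>F n\<^esub> \<in> G n a" by (rule additive_subgroup.zero_closed[OF gc.G_subgroup])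
  have C_ne: "C a \<noteq> {}" using additive_subgroup.zero_closed[OF T.C_subgroup[OF aI]] by blast
  have lower_ne: "lower F G a n \<noteq> {}" unfolding lower using T.G.submodule_sum_zero by blast
  have lower_carrier: "lower F G a n \<subseteq> carrier (F n)"
    unfolding lower by (rule additive_subgroup.a_subset[OF gc.G_sum_subgroup])
  have Ga: "G n a \<subseteq> lower F G a n" using gc.G_lower by blast
  have M_ne: "M a \<noteq> {}" unfolding M gv.stratum_parts using N0 by blast
  \<comment> \<open>Vanishing is stated as equality of the image with the zero module, which is why
    the sets involved were shown to be nonempty.\<close>
  have zeroI: "f ` X = {\<zero>\<^bsub>F n\<^esub>}" if "X \<noteq> {}" "\<And>x. x \<in> X \<Longrightarrow> f x = \<zero>\<^bsub>F n\<^esub>"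
    for X :: "'m set" and f :: "'m \<Rightarrow> 'm"
    using that by auto
  have iso: "\<Phi> ^^ k \<in> module_iso R ((F n)\<lparr>carrier := C c\<rparr>) ((F n)\<lparr>carrier := (\<Phi> ^^ k) ` C c\<rparr>)"
    if "c \<in> ?I" for k c
    using \<Phi>[of k] T.C_carrier[OF that] T.power_C_inj[OF that, of k]
    by (auto simp: module_iso_def module_hom_def bij_betw_def subset_iff)
  have stable_direct: "direct (F n) ?I (\<lambda>b. (\<Phi> ^^ d b) ` C b)" by (rule T.power_C_direct)
  have stable_direct': "direct (F n) {b\<in>P\<^sub>n. b < a} (\<lambda>b. (\<Phi> ^^ d b) ` C b)"
    using stable_direct unfolding direct_def by (auto simp: subset_iff less_le)
  have M_direct: "direct (F n) {b\<in>P\<^sub>n. b < a} M"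
    by (rule T.G.direct_mono[OF T.S_subgroup T.S_direct _ T.M_subset]) auto
  have claims: "(\<Phi> ^^ k) ` M a = {\<zero>\<^bsub>F n\<^esub>}
        \<and> (direct (F n) {b\<in>P\<^sub>n. b < a} M
            \<and> (\<lambda>x. \<Phi> x \<ominus>\<^bsub>F n\<^esub> x) ` C a \<subseteq> submodule_sum (F n) {b\<in>P\<^sub>n. b < a} M)
        \<and> (\<lambda>x. (\<Phi> ^^ k) x \<ominus>\<^bsub>F n\<^esub> (\<Phi> ^^ (k - 1)) x) ` C a = {\<zero>\<^bsub>F n\<^esub>}
        \<and> (direct (F n) {b\<in>P\<^sub>n. b < a} (\<lambda>b. (\<Phi> ^^ d b) ` C b)
            \<and> (\<Phi> ^^ k) ` N a \<subseteq> submodule_sum (F n) {b\<in>P\<^sub>n. b < a} (\<lambda>b. (\<Phi> ^^ d b) ` C b))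
        \<and> (\<lambda>x. (\<Phi> ^^ (k + 1)) x \<ominus>\<^bsub>F n\<^esub> (\<Phi> ^^ k) x) ` G n a = {\<zero>\<^bsub>F n\<^esub>}
        \<and> (direct (F n) {b\<in>P\<^sub>n. b \<le> a} (\<lambda>b. (\<Phi> ^^ d b) ` C b)
            \<and> (\<Phi> ^^ k) ` G n a \<subseteq> submodule_sum (F n) {b\<in>P\<^sub>n. b \<le> a} (\<lambda>b. (\<Phi> ^^ d b) ` C b))
        \<and> (\<lambda>x. (\<Phi> ^^ (k + 1)) x \<ominus>\<^bsub>F n\<^esub> (\<Phi> ^^ k) x) ` lower F G a n = {\<zero>\<^bsub>F n\<^esub>}
        \<and> is_direct_sum (F n) ((\<Phi> ^^ k) ` lower F G a n) {b\<in>P\<^sub>n. b \<le> a} (\<lambda>b. (\<Phi> ^^ d b) ` C b)"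
    if k: "d a < k" for k
  proof -
    have sum: "(\<Phi> ^^ k) ` lower F G a n = submodule_sum (F n) ?I (\<lambda>b. (\<Phi> ^^ d b) ` C b)"
      unfolding lower using d_le k by (intro T.power_S_sum) (auto intro: le_less_trans)
    \<comment> \<open>After \<open>k\<close> steps all of F(a) in degree n has reached the sum of
      the stable images, where \<open>\<Phi>\<close> is the identity. Since \<open>G n a\<close> is
      part of it, this serves both claims about consecutive powers on \<open>G n a\<close> and on
      F(a).\<close>
    have fixed: "(\<Phi> ^^ (k + 1)) x \<ominus>\<^bsub>F n\<^esub> (\<Phi> ^^ k) x = \<zero>\<^bsub>F n\<^esub>" if "x \<in> lower F G a n" for x
    proof -
      have "(\<Phi> ^^ k) x \<in> submodule_sum (F n) ?I (\<lambda>b. (\<Phi> ^^ d b) ` C b)" using sum that by blast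
      then have "\<Phi> ((\<Phi> ^^ k) x) = (\<Phi> ^^ k) x" by (intro T.stable_sum_fixed) auto
      moreover have "(\<Phi> ^^ k) x \<in> carrier (F n)" using that lower_carrier carr by blast
      ultimately show ?thesis by (simp add: a_minus_def T.G.r_neg)
    qed
    \<comment> \<open>The exponent \<open>k - 1\<close> may equal \<open>d a\<close>, which is just
      enough for \<open>T.power_Suc_C\<close>.\<close>
    have Suc_k: "k = Suc (k - 1)" "d a \<le> k - 1" using k by simp_all
    have C_fixed: "(\<Phi> ^^ k) x \<ominus>\<^bsub>F n\<^esub> (\<Phi> ^^ (k - 1)) x = \<zero>\<^bsub>F n\<^esub>" if "x \<in> C a" for x
    proof -
      have "(\<Phi> ^^ k) x = (\<Phi> ^^ (k - 1)) x" using T.power_Suc_C[OF aI that Suc_k(2)] Suc_k(1) by simp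
      moreover have "(\<Phi> ^^ (k - 1)) x \<in> carrier (F n)" using that T.C_carrier[OF aI] carr by blast
      ultimately show ?thesis by (simp add: a_minus_def T.G.r_neg)
    qed
    show ?thesis
    proof (intro conjI)
      show "(\<Phi> ^^ k) ` M a = {\<zero>\<^bsub>F n\<^esub>}" using M_ne T.power_M[OF aI _ k] by (rule zeroI)
      show "(\<lambda>x. \<Phi> x \<ominus>\<^bsub>F n\<^esub> x) ` C a \<subseteq> submodule_sum (F n) {b\<in>P\<^sub>n. b < a} M"
        using T.\<Phi>_C[OF aI] unfolding less by blast
      show "direct (F n) {b\<in>P\<^sub>n. b < a} M" by (rule M_direct)
      show "direct (F n) {b\<in>P\<^sub>n. b < a} (\<lambda>b. (\<Phi> ^^ d b) ` C b)" by (rule stable_direct')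
      show "direct (F n) ?I (\<lambda>b. (\<Phi> ^^ d b) ` C b)" by (rule stable_direct)
      show "(\<lambda>x. (\<Phi> ^^ k) x \<ominus>\<^bsub>F n\<^esub> (\<Phi> ^^ (k - 1)) x) ` C a = {\<zero>\<^bsub>F n\<^esub>}"
        using C_ne C_fixed by (rule zeroI)
      show "(\<Phi> ^^ k) ` N a \<subseteq> submodule_sum (F n) {b\<in>P\<^sub>n. b < a} (\<lambda>b. (\<Phi> ^^ d b) ` C b)"
        using T.power_N_S[OF aI k] unfolding less by blast
      show "(\<lambda>x. (\<Phi> ^^ (k + 1)) x \<ominus>\<^bsub>F n\<^esub> (\<Phi> ^^ k) x) ` G n a = {\<zero>\<^bsub>F n\<^esub>}"
        using N0 fixed Ga by (intro zeroI) blast+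
      show "(\<Phi> ^^ k) ` G n a \<subseteq> submodule_sum (F n) ?I (\<lambda>b. (\<Phi> ^^ d b) ` C b)"
        using sum Ga by blast
      show "(\<lambda>x. (\<Phi> ^^ (k + 1)) x \<ominus>\<^bsub>F n\<^esub> (\<Phi> ^^ k) x) ` lower F G a n = {\<zero>\<^bsub>F n\<^esub>}"
        using lower_ne fixed by (rule zeroI)
      show "is_direct_sum (F n) ((\<Phi> ^^ k) ` lower F G a n) ?I (\<lambda>b. (\<Phi> ^^ d b) ` C b)"
        unfolding is_direct_sum_def using stable_direct sum by blast
    qed
  qed
  have "direct (F n) ?I (\<lambda>c. (\<Phi> ^^ k c) ` C c) \<and> (\<forall>c\<in>P\<^sub>n. c \<le> a \<longrightarrow>
      \<Phi> ^^ k c \<in> module_iso R ((F n)\<lparr>carrier := C c\<rparr>) ((F n)\<lparr>carrier := (\<Phi> ^^ k c) ` C c\<rparr>))" for k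
    using T.power_C_direct iso by simp
  then show ?thesis
    by (intro conjI[of "All _" "All _"] allI impI claims)
qed

end
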